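(* Let $\diamond\in\{\mathrm d,\mathrm p\}$, $\#\in\{\mathrm{ET},\mathrm{ST}\}$, and $\tau\le\min_{a\in[0,a_2^*]}\mathrm{MIET}(a)$. Then the Adaptive Displaced-Gradient Algorithm (with stepsize rule $\mathrm{step}^\diamond_\#$ and stepsize lower bound parameter $\tau$) has the following properties: (i) it is executable, i.e., at each iteration, the parameter $a$ is determined in a finite number of steps; (ii) the stepsize $\Delta_k$ is uniformly lower bounded by $\tau$; (iii) it satisfies $f(x_{k+1})-f(x_* )=\mathcal O\big(e^{-\frac{\sqrt\mu}{4}\sum_{i=0}^k\Delta_i}\big)$ for $k\in\{0\}\cup\mathbb{N}$.
   Context: Let $\mu,L,s>0$, and let $f:\mathbb{R}^n\to\mathbb{R}$ be continuously differentiable, $\mu$-strongly convex (i.e. $f(y)-f(x)\ge\langle\nabla f(x),y-x\rangle+\frac{\mu}{2}\|x-y\|^2$ for all $x,y$), with $L$-Lipschitz gradient; $x_*$ is its unique minimizer. Norms are Euclidean. Notation: $\sqrt{\mu_s}=1+\sqrt{\mu s}$, so $\mu_s=(1+\sqrt{\mu s})^2$. For $a\ge0$, $$X^a_{\mathrm{hb}}(x,v)=\begin{bmatrix} v\\ -2\sqrt{\mu}\,v-\sqrt{\mu_s}\,\nabla f(x+av)\end{bmatrix}.$$ For $\hat p=[\hat x,\hat v]^T$ write $\hat g=\nabla f(\hat x+a\hat v)$ and define $$b^{\mathrm d}_{\mathrm{ET}}(\hat p,t;a)=A_{\mathrm{ET}}(\hat p,t;a)+B_{\mathrm{ET}}(\hat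 p,t;a)+C_{\mathrm{ET}}(\hat p;a),$$ $$b^{\mathrm d}_{\mathrm{ST}}(\hat p,t;a)=B^q_{\mathrm{ST}}(\hat p;a)t^2+(A_{\mathrm{ST}}(\hat p;a)+B^l_{\mathrm{ST}}(\hat p;a))t+C_{\mathrm{ST}}(\hat p;a),$$ where $$A_{\mathrm{ET}}(\hat p,t;a)=2\mu t\|\hat v\|^2+\sqrt{\mu_s}\big(\langle\nabla f(\hat x+t\hat v)-\nabla f(\hat x),\hat v\rangle+2t\sqrt\mu\langle\hat g,\hat v\rangle+t\sqrt{\mu_s}\|\hat g\|^2\big),$$ $$B_{\mathrm{ET}}(\hat p,t;a)=\frac{\sqrt\mu t^2}{16}\|2\sqrt\mu\hat v+\sqrt{\mu_s}\hat g\|^2-\frac{t\mu}{4}\|\hat v\|^2+\frac{\sqrt\mu\sqrt{\mu_s}}{4}\Big(f(\hat x+t\hat v)-f(\hat x)-t\langle\hat v,\hat g\rangle+\frac{t^2\sqrt{\mu_s}}{4}\|\hat g\|^2-\frac{t\sqrt\mu}{L}\|\hat g\|^2+t\sqrt\mu\langle a\hat v,\hat g\rangle\Big),$$ $$C_{\mathrm{ET}}(\hat p;a)=-\frac{13\sqrt\mu}{16}\|\hat v\|^2-\frac{\mu^2\sqrt s}{2}\frac{\|\nabla f(\hat x)\|^2}{L^2}+\sqrt{\mu_s}\Big(-\frac{3\sqrt\mu}{8L}\|\nabla f(\hat x)\|^2+\sqrt\mu(f(\hat x)-f(\hat x+a\hat v))+\sqrt\mu\|\nabla f(\hat x)\|\|a\hat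 v\|-\frac{\mu^{3/2}}{2}\|a\hat v\|^2-\langle\hat g-\nabla f(\hat x),\hat v\rangle+\sqrt\mu\langle\hat g,a\hat v\rangle\Big),$$ $$A_{\mathrm{ST}}(\hat p;a)=2\mu\|\hat v\|^2+\sqrt{\mu_s}\big(L\|\hat v\|^2+2\sqrt\mu\langle\hat g,\hat v\rangle+\sqrt{\mu_s}\|\hat g\|^2\big),$$ $$B^l_{\mathrm{ST}}(\hat p;a)=\frac{\sqrt\mu}{4}\Big(-\sqrt\mu\|\hat v\|^2+\sqrt{\mu_s}\big(\langle\nabla f(\hat x)-\hat g,\hat v\rangle-\frac{\sqrt\mu}{L}\|\hat g\|^2+\sqrt\mu\langle a\hat v,\hat g\rangle\big)\Big),$$ $$B^q_{\mathrm{ST}}(\hat p;a)=\frac{\sqrt\mu}{16}\|2\sqrt\mu\hat v+\sqrt{\mu_s}\hat g\|^2+\frac{\sqrt\mu\sqrt{\mu_s}}{4}\Big(\frac L2\|\hat v\|^2+\frac{\sqrt{\mu_s}}{4}\|\hat g\|^2\Big),$$ $$C_{\mathrm{ST}}(\hat p;a)=C_{\mathrm{ET}}(\hat p;a).$$ Further, $b^{\mathrm p}_{\#}(\hat p,t;a)=\int_0^te^{\frac{\sqrt\mu}{4}\zeta}b^{\mathrm d}_{\#}(\hat p,\zeta;a)\,d\zeta$, and the stepsizes are $\mathrm{step}^{\diamond}_{\#}(\hat p;a)=\min\{t>0: b^{\diamond}_{\#}(\hat p,t;a)=0\}$, for $\diamond\in\{\mathrm d,\mathrm p\}$, $\#\in\{\mathrm{ET},\mathrm{ST}\}$.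 Constants: let $$\hat\beta_1=\sqrt{\mu_s}\Big(\frac{3\sqrt\mu}{2}+L\Big),\quad \hat\beta_2=\frac32\sqrt\mu\sqrt{\mu_s},\quad \hat\beta_3=\frac{13\sqrt\mu}{16},\quad \hat\beta_4=\frac{4\mu^2\sqrt s+3L\sqrt\mu\sqrt{\mu_s}}{8L^2},\quad \hat\beta_5=\sqrt{\mu_s}\Big(\frac{5\sqrt\mu L}{2}-\frac{\mu^{3/2}}{2}\Big),$$ and, for a fixed $0<\alpha<1$, $$a_2^*=\alpha\min\Big\{\frac{-\hat\beta_1+\sqrt{\hat\beta_1^2+4\hat\beta_5\hat\beta_3}}{2\hat\beta_5},\ \frac{\hat\beta_4}{\hat\beta_2}\Big\}.$$ For $a\in[0,a_2^*]$, $\mathrm{MIET}(a)=-\nu+\sqrt{\nu^2+\eta}$, with $\eta=\min\{\eta_1,\eta_2\}$, $\nu=\max\{\nu_1,\nu_2\}$ and $$\eta_1=\frac{8a\sqrt{\mu_s}\big(a(\mu-5L)-\frac{2L}{\sqrt\mu}-3\big)+13}{2\sqrt{\mu_s}L(3a^2\sqrt{\mu_s}L+1)+8\mu},\qquad \eta_2=-\frac{3\sqrt{\mu_s}\sqrt\mu L(4aL-1)-4\mu^2\sqrt s}{3\mu_s\sqrt\mu L^2},$$ $$\nu_1=\frac{\mu(2a^3\sqrt{\mu_s}L^2+a\sqrt{\mu_s}+16)+8\sqrt{\mu_s}L(2a^2\sqrt{\mu_s}L+1)}{2\sqrt\mu\big(\sqrt{\mu_s}L(3a^2\sqrt{\mu_s}L+1)+4\mu\big)}+\frac{\sqrt{\mu_s}(aL(8aL+1)+4)}{\sqrt{\mu_s}L(3a^2\sqrt{\mu_s}L+1)+4\mu},$$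 $$\nu_2=\frac{a\mu+8\sqrt{\mu_s}+8\sqrt\mu}{3\sqrt{\mu_s}\sqrt\mu}.$$ Adaptive Displaced-Gradient Algorithm: the inputs are an initial point $p_0=[x_0,v_0]^T$, a tolerance $\epsilon>0$, an increase rate $r_i>1$, a decrease rate $0<r_d<1$, a stepsize lower bound parameter $\tau$, and an initial value $a\ge0$; start with $k=0$. While $\|\nabla f(x_k)\|\ge\epsilon$, perform the following iteration. (1) Starting from the current value of $a$, repeatedly replace $a$ by $a\,r_d$ as long as either $C_\#(p_k;a)\ge0$, or $C_\#(p_k;a)<0$ and $\mathrm{step}^\diamond_\#(p_k;a)<\tau$; stop at the first value of $a$ with $C_\#(p_k;a)<0$ and $\mathrm{step}^\diamond_\#(p_k;a)\ge\tau$. (2) Set $\Delta_k=\mathrm{step}^\diamond_\#(p_k;a)$ and $p_{k+1}=[x_{k+1},v_{k+1}]^T=p_k+\Delta_kX^a_{\mathrm{hb}}(p_k)$. (3) Increase $k$ by one and, if no decrease of $a$ took place in (1), replace $a$ by $a\,r_i$. Assertions indexed by $k$ refer to the iterations actually performed. The $\mathcal O(\cdot)$ means an upper bound by a constant independent of $k$ times the given expression. *)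

theory Defs
  imports "HOL-Analysis.Analysis" "HOL-Library.While_Combinator"
begin

section \<open>The objective function\<close>

definition grad :: "('a::real_inner \<Rightarrow> real) \<Rightarrow> 'a \<Rightarrow> 'a" where
  "grad f x = (THE g. GDERIV f x :> g)"

definition cont_diff :: "('a::real_inner \<Rightarrow> real) \<Rightarrow> bool" where
  "cont_diff f \<longleftrightarrow> f differentiable_on UNIV \<and> continuous_on UNIV (grad f)"

definition strongly_convex :: "real \<Rightarrow> ('a::real_inner \<Rightarrow> real) \<Rightarrow> bool" where
  "strongly_convex \<mu> f \<longleftrightarrow>
     (\<forall>x y. f y - f x \<ge> grad f x \<bullet> (y - x) + \<mu> / 2 * (norm (x - y))\<^sup>2)"

section \<open>The displaced-gradient heavy-ball vector field\<close>

text \<open>\<open>sqrt_mus \<mu> s\<close> stands for $\sqrt{\mu_s}$, and \<open>mus \<mu> s\<close> for $\mu_s$.\<close>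

definition sqrt_mus :: "real \<Rightarrow> real \<Rightarrow> real" where
  "sqrt_mus \<mu> s = 1 + sqrt (\<mu> * s)"

definition mus :: "real \<Rightarrow> real \<Rightarrow> real" where
  "mus \<mu> s = (sqrt_mus \<mu> s)\<^sup>2"

fun X_hb :: "('a::real_inner \<Rightarrow> real) \<Rightarrow> real \<Rightarrow> real \<Rightarrow> real \<Rightarrow> 'a \<times> 'a \<Rightarrow> 'a \<times> 'a" where
  "X_hb f \<mu> s a (x, v) =
     (v, - (2 * sqrt \<mu>) *\<^sub>R v - sqrt_mus \<mu> s *\<^sub>R grad f (x + a *\<^sub>R v))"

section \<open>The triggering functions\<close>

fun A_ET :: "('a::real_inner \<Rightarrow> real) \<Rightarrow> real \<Rightarrow> real \<Rightarrow> 'a \<times> 'a \<Rightarrow> real \<Rightarrow> real \<Rightarrow> real" where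
  "A_ET f \<mu> s (x, v) t a =
     (let g = grad f (x + a *\<^sub>R v) in
        2 * \<mu> * t * (norm v)\<^sup>2
        + sqrt_mus \<mu> s *
            ((grad f (x + t *\<^sub>R v) - grad f x) \<bullet> v
             + 2 * t * sqrt \<mu> * (g \<bullet> v)
             + t * sqrt_mus \<mu> s * (norm g)\<^sup>2))"

fun B_ET :: "('a::real_inner \<Rightarrow> real) \<Rightarrow> real \<Rightarrow> real \<Rightarrow> real \<Rightarrow> 'a \<times> 'a \<Rightarrow> real \<Rightarrow> real \<Rightarrow> real" where
  "B_ET f \<mu> L s (x, v) t a =
     (let g = grad f (x + a *\<^sub>R v) in
        sqrt \<mu> * t\<^sup>2 / 16 * (norm ((2 * sqrt \<mu>) *\<^sub>R v + sqrt_mus \<mu> s *\<^sub>R g))\<^sup>2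
        - t * \<mu> / 4 * (norm v)\<^sup>2
        + sqrt \<mu> * sqrt_mus \<mu> s / 4 *
            (f (x + t *\<^sub>R v) - f x - t * (v \<bullet> g)
             + t\<^sup>2 * sqrt_mus \<mu> s / 4 * (norm g)\<^sup>2
             - t * sqrt \<mu> / L * (norm g)\<^sup>2
             + t * sqrt \<mu> * ((a *\<^sub>R v) \<bullet> g)))"

fun C_ET :: "('a::real_inner \<Rightarrow> real) \<Rightarrow> real \<Rightarrow> real \<Rightarrow> real \<Rightarrow> 'a \<times> 'a \<Rightarrow> real \<Rightarrow> real" where
  "C_ET f \<mu> L s (x, v) a =
     (let g = grad f (x + a *\<^sub>R v) in
        - (13 * sqrt \<mu> / 16) * (norm v)\<^sup>2
        - \<mu>\<^sup>2 * sqrt s / 2 * ((norm (grad f x))\<^sup>2 / L\<^sup>2)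
        + sqrt_mus \<mu> s *
            (- (3 * sqrt \<mu> / (8 * L)) * (norm (grad f x))\<^sup>2
             + sqrt \<mu> * (f x - f (x + a *\<^sub>R v))
             + sqrt \<mu> * norm (grad f x) * norm (a *\<^sub>R v)
             - \<mu> powr (3/2) / 2 * (norm (a *\<^sub>R v))\<^sup>2
             - (g - grad f x) \<bullet> v
             + sqrt \<mu> * (g \<bullet> (a *\<^sub>R v))))"

fun A_ST :: "('a::real_inner \<Rightarrow> real) \<Rightarrow> real \<Rightarrow> real \<Rightarrow> real \<Rightarrow> 'a \<times> 'a \<Rightarrow> real \<Rightarrow> real" where
  "A_ST f \<mu> L s (x, v) a =
     (let g = grad f (x + a *\<^sub>R v) in
        2 * \<mu> * (norm v)\<^sup>2
        + sqrt_mus \<mu> s *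
            (L * (norm v)\<^sup>2 + 2 * sqrt \<mu> * (g \<bullet> v) + sqrt_mus \<mu> s * (norm g)\<^sup>2))"

fun Bl_ST :: "('a::real_inner \<Rightarrow> real) \<Rightarrow> real \<Rightarrow> real \<Rightarrow> real \<Rightarrow> 'a \<times> 'a \<Rightarrow> real \<Rightarrow> real" where
  "Bl_ST f \<mu> L s (x, v) a =
     (let g = grad f (x + a *\<^sub>R v) in
        sqrt \<mu> / 4 *
          (- sqrt \<mu> * (norm v)\<^sup>2
           + sqrt_mus \<mu> s *
               ((grad f x - g) \<bullet> v
                - sqrt \<mu> / L * (norm g)\<^sup>2
                + sqrt \<mu> * ((a *\<^sub>R v) \<bullet> g))))"

fun Bq_ST :: "('a::real_inner \<Rightarrow> real) \<Rightarrow> real \<Rightarrow> real \<Rightarrow> real \<Rightarrow> 'a \<times> 'a \<Rightarrow> real \<Rightarrow> real" where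
  "Bq_ST f \<mu> L s (x, v) a =
     (let g = grad f (x + a *\<^sub>R v) in
        sqrt \<mu> / 16 * (norm ((2 * sqrt \<mu>) *\<^sub>R v + sqrt_mus \<mu> s *\<^sub>R g))\<^sup>2
        + sqrt \<mu> * sqrt_mus \<mu> s / 4 *
            (L / 2 * (norm v)\<^sup>2 + sqrt_mus \<mu> s / 4 * (norm g)\<^sup>2))"

definition C_ST :: "('a::real_inner \<Rightarrow> real) \<Rightarrow> real \<Rightarrow> real \<Rightarrow> real \<Rightarrow> 'a \<times> 'a \<Rightarrow> real \<Rightarrow> real" where
  "C_ST f \<mu> L s p a = C_ET f \<mu> L s p a"

text \<open>Event-triggered (\<open>ET\<close>) versus self-triggered (\<open>ST\<close>) rules, and
  derivative-based (\<open>Deriv\<close>) versus performance-based (\<open>Perf\<close>) rules.\<close>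

datatype trig = ET | ST

datatype crit = Deriv | Perf

fun C_trig ::
  "trig \<Rightarrow> ('a::real_inner \<Rightarrow> real) \<Rightarrow> real \<Rightarrow> real \<Rightarrow> real \<Rightarrow> 'a \<times> 'a \<Rightarrow> real \<Rightarrow> real" where
  "C_trig ET f \<mu> L s p a = C_ET f \<mu> L s p a"
| "C_trig ST f \<mu> L s p a = C_ST f \<mu> L s p a"

fun b_d ::
  "trig \<Rightarrow> ('a::real_inner \<Rightarrow> real) \<Rightarrow> real \<Rightarrow> real \<Rightarrow> real \<Rightarrow> 'a \<times> 'a \<Rightarrow> real \<Rightarrow> real \<Rightarrow> real" where
  "b_d ET f \<mu> L s p t a = A_ET f \<mu> s p t a + B_ET f \<mu> L s p t a + C_ET f \<mu> L s p a"
| "b_d ST f \<mu> L s p t a =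
     Bq_ST f \<mu> L s p a * t\<^sup>2 + (A_ST f \<mu> L s p a + Bl_ST f \<mu> L s p a) * t + C_ST f \<mu> L s p a"

text \<open>Only used for \<open>t > 0\<close>; the set integral would be \<open>0\<close> for \<open>t < 0\<close>.\<close>

definition b_p ::
  "trig \<Rightarrow> ('a::real_inner \<Rightarrow> real) \<Rightarrow> real \<Rightarrow> real \<Rightarrow> real \<Rightarrow> 'a \<times> 'a \<Rightarrow> real \<Rightarrow> real \<Rightarrow> real" where
  "b_p h f \<mu> L s p t a =
     integral {0..t} (\<lambda>\<zeta>. exp (sqrt \<mu> / 4 * \<zeta>) * b_d h f \<mu> L s p \<zeta> a)"

fun b_fun ::
  "crit \<Rightarrow> trig \<Rightarrow> ('a::real_inner \<Rightarrow> real) \<Rightarrow> real \<Rightarrow> real \<Rightarrow> real \<Rightarrow> 'a \<times> 'a \<Rightarrow> real \<Rightarrow> real \<Rightarrow> real" where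
  "b_fun Deriv h f \<mu> L s p t a = b_d h f \<mu> L s p t a"
| "b_fun Perf h f \<mu> L s p t a = b_p h f \<mu> L s p t a"

text \<open>The minimum of the set of positive zeros; unspecified if there is no such minimum.\<close>

definition stepsize ::
  "crit \<Rightarrow> trig \<Rightarrow> ('a::real_inner \<Rightarrow> real) \<Rightarrow> real \<Rightarrow> real \<Rightarrow> real \<Rightarrow> 'a \<times> 'a \<Rightarrow> real \<Rightarrow> real" where
  "stepsize d h f \<mu> L s p a = (LEAST t. t > 0 \<and> b_fun d h f \<mu> L s p t a = 0)"

section \<open>The constants and the minimum inter-event time\<close>

definition beta1 :: "real \<Rightarrow> real \<Rightarrow> real \<Rightarrow> real" where
  "beta1 \<mu> L s = sqrt_mus \<mu> s * (3 * sqrt \<mu> / 2 + L)"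

definition beta2 :: "real \<Rightarrow> real \<Rightarrow> real" where
  "beta2 \<mu> s = 3 / 2 * sqrt \<mu> * sqrt_mus \<mu> s"

definition beta3 :: "real \<Rightarrow> real" where
  "beta3 \<mu> = 13 * sqrt \<mu> / 16"

definition beta4 :: "real \<Rightarrow> real \<Rightarrow> real \<Rightarrow> real" where
  "beta4 \<mu> L s = (4 * \<mu>\<^sup>2 * sqrt s + 3 * L * sqrt \<mu> * sqrt_mus \<mu> s) / (8 * L\<^sup>2)"

definition beta5 :: "real \<Rightarrow> real \<Rightarrow> real \<Rightarrow> real" where
  "beta5 \<mu> L s = sqrt_mus \<mu> s * (5 * sqrt \<mu> * L / 2 - \<mu> powr (3/2) / 2)"

definition a2_star :: "real \<Rightarrow> real \<Rightarrow> real \<Rightarrow> real \<Rightarrow> real" where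
  "a2_star \<mu> L s \<alpha> =
     \<alpha> * min ((- beta1 \<mu> L s + sqrt ((beta1 \<mu> L s)\<^sup>2 + 4 * beta5 \<mu> L s * beta3 \<mu>))
                 / (2 * beta5 \<mu> L s))
             (beta4 \<mu> L s / beta2 \<mu> s)"

definition eta1 :: "real \<Rightarrow> real \<Rightarrow> real \<Rightarrow> real \<Rightarrow> real" where
  "eta1 \<mu> L s a =
     (8 * a * sqrt_mus \<mu> s * (a * (\<mu> - 5 * L) - 2 * L / sqrt \<mu> - 3) + 13)
     / (2 * sqrt_mus \<mu> s * L * (3 * a\<^sup>2 * sqrt_mus \<mu> s * L + 1) + 8 * \<mu>)"

definition eta2 :: "real \<Rightarrow> real \<Rightarrow> real \<Rightarrow> real \<Rightarrow> real" where
  "eta2 \<mu> L s a =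
     - ((3 * sqrt_mus \<mu> s * sqrt \<mu> * L * (4 * a * L - 1) - 4 * \<mu>\<^sup>2 * sqrt s)
        / (3 * mus \<mu> s * sqrt \<mu> * L\<^sup>2))"

definition nu1 :: "real \<Rightarrow> real \<Rightarrow> real \<Rightarrow> real \<Rightarrow> real" where
  "nu1 \<mu> L s a =
     (\<mu> * (2 * a ^ 3 * sqrt_mus \<mu> s * L\<^sup>2 + a * sqrt_mus \<mu> s + 16)
        + 8 * sqrt_mus \<mu> s * L * (2 * a\<^sup>2 * sqrt_mus \<mu> s * L + 1))
     / (2 * sqrt \<mu> * (sqrt_mus \<mu> s * L * (3 * a\<^sup>2 * sqrt_mus \<mu> s * L + 1) + 4 * \<mu>))
     + sqrt_mus \<mu> s * (a * L * (8 * a * L + 1) + 4)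
       / (sqrt_mus \<mu> s * L * (3 * a\<^sup>2 * sqrt_mus \<mu> s * L + 1) + 4 * \<mu>)"

definition nu2 :: "real \<Rightarrow> real \<Rightarrow> real \<Rightarrow> real" where
  "nu2 \<mu> s a =
     (a * \<mu> + 8 * sqrt_mus \<mu> s + 8 * sqrt \<mu>) / (3 * sqrt_mus \<mu> s * sqrt \<mu>)"

definition MIET :: "real \<Rightarrow> real \<Rightarrow> real \<Rightarrow> real \<Rightarrow> real" where
  "MIET \<mu> L s a =
     (let \<eta> = min (eta1 \<mu> L s a) (eta2 \<mu> L s a);
          \<nu> = max (nu1 \<mu> L s a) (nu2 \<mu> s a)
      in - \<nu> + sqrt (\<nu>\<^sup>2 + \<eta>))"

section \<open>The adaptive displaced-gradient algorithm\<close>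

definition must_decrease ::
  "crit \<Rightarrow> trig \<Rightarrow> ('a::real_inner \<Rightarrow> real) \<Rightarrow> real \<Rightarrow> real \<Rightarrow> real \<Rightarrow> real \<Rightarrow> 'a \<times> 'a \<Rightarrow> real \<Rightarrow> bool" where
  "must_decrease d h f \<mu> L s \<tau> p a \<longleftrightarrow>
     C_trig h f \<mu> L s p a \<ge> 0 \<or>
     (C_trig h f \<mu> L s p a < 0 \<and> stepsize d h f \<mu> L s p a < \<tau>)"

text \<open>The inner loop; the result is \<open>None\<close> iff the loop does not terminate.\<close>

definition search_a ::
  "crit \<Rightarrow> trig \<Rightarrow> ('a::real_inner \<Rightarrow> real) \<Rightarrow> real \<Rightarrow> real \<Rightarrow> real \<Rightarrow> real \<Rightarrow> real \<Rightarrow>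
   'a \<times> 'a \<Rightarrow> real \<Rightarrow> real option" where
  "search_a d h f \<mu> L s \<tau> rd p a =
     while_option (must_decrease d h f \<mu> L s \<tau> p) (\<lambda>a. a * rd) a"

text \<open>The state at the beginning of iteration \<open>k\<close>: the point \<open>p\<^sub>k = (x\<^sub>k, v\<^sub>k)\<close> and the current
  value of \<open>a\<close>. The outer stopping test is not part of the recursion (see \<open>performed\<close> below), so
  that the sequence does not depend on the tolerance; it is meaningful only as long as the algorithm
  actually runs.\<close>

primrec adg_state ::
  "crit \<Rightarrow> trig \<Rightarrow> ('a::real_inner \<Rightarrow> real) \<Rightarrow> real \<Rightarrow> real \<Rightarrow> real \<Rightarrow> real \<Rightarrow> real \<Rightarrow> real \<Rightarrow>
   'a \<times> 'a \<Rightarrow> real \<Rightarrow> nat \<Rightarrow> ('a \<times> 'a) \<times> real" where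
  "adg_state d h f \<mu> L s \<tau> ri rd p0 a0 0 = (p0, a0)"
| "adg_state d h f \<mu> L s \<tau> ri rd p0 a0 (Suc k) =
     (let (p, a) = adg_state d h f \<mu> L s \<tau> ri rd p0 a0 k;
          a' = the (search_a d h f \<mu> L s \<tau> rd p a);
          \<Delta> = stepsize d h f \<mu> L s p a'
      in (p + \<Delta> *\<^sub>R X_hb f \<mu> s a' p,
          if must_decrease d h f \<mu> L s \<tau> p a then a' else a' * ri))"

definition adg_x ::
  "crit \<Rightarrow> trig \<Rightarrow> ('a::real_inner \<Rightarrow> real) \<Rightarrow> real \<Rightarrow> real \<Rightarrow> real \<Rightarrow> real \<Rightarrow> real \<Rightarrow> real \<Rightarrow>
   'a \<times> 'a \<Rightarrow> real \<Rightarrow> nat \<Rightarrow> 'a" where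
  "adg_x d h f \<mu> L s \<tau> ri rd p0 a0 k = fst (fst (adg_state d h f \<mu> L s \<tau> ri rd p0 a0 k))"

definition adg_search ::
  "crit \<Rightarrow> trig \<Rightarrow> ('a::real_inner \<Rightarrow> real) \<Rightarrow> real \<Rightarrow> real \<Rightarrow> real \<Rightarrow> real \<Rightarrow> real \<Rightarrow> real \<Rightarrow>
   'a \<times> 'a \<Rightarrow> real \<Rightarrow> nat \<Rightarrow> real option" where
  "adg_search d h f \<mu> L s \<tau> ri rd p0 a0 k =
     (let (p, a) = adg_state d h f \<mu> L s \<tau> ri rd p0 a0 k in search_a d h f \<mu> L s \<tau> rd p a)"

definition adg_step ::
  "crit \<Rightarrow> trig \<Rightarrow> ('a::real_inner \<Rightarrow> real) \<Rightarrow> real \<Rightarrow> real \<Rightarrow> real \<Rightarrow> real \<Rightarrow> real \<Rightarrow> real \<Rightarrow>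
   'a \<times> 'a \<Rightarrow> real \<Rightarrow> nat \<Rightarrow> real" where
  "adg_step d h f \<mu> L s \<tau> ri rd p0 a0 k =
     stepsize d h f \<mu> L s (fst (adg_state d h f \<mu> L s \<tau> ri rd p0 a0 k))
       (the (adg_search d h f \<mu> L s \<tau> ri rd p0 a0 k))"

text \<open>With tolerance \<open>\<epsilon>\<close>, the algorithm enters iteration \<open>k\<close>: the outer test succeeded up to and
  including \<open>k\<close>, and every earlier inner loop terminated.\<close>

definition performed ::
  "crit \<Rightarrow> trig \<Rightarrow> ('a::real_inner \<Rightarrow> real) \<Rightarrow> real \<Rightarrow> real \<Rightarrow> real \<Rightarrow> real \<Rightarrow> real \<Rightarrow> real \<Rightarrow>
   'a \<times> 'a \<Rightarrow> real \<Rightarrow> real \<Rightarrow> nat \<Rightarrow> bool" where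
  "performed d h f \<mu> L s \<tau> ri rd p0 a0 \<epsilon> k \<longleftrightarrow>
     (\<forall>j\<le>k. norm (grad f (adg_x d h f \<mu> L s \<tau> ri rd p0 a0 j)) \<ge> \<epsilon>) \<and>
     (\<forall>j<k. adg_search d h f \<mu> L s \<tau> ri rd p0 a0 j \<noteq> None)"

end

theory Submission
  imports Defs
begin

text \<open>
  Let $V(x,v) = \sqrt{\mu_s}\,(f(x)-f(x_*)) + \frac14\|v\|^2 + \frac14\|v+2\sqrt\mu\,(x-x_*)\|^2$.
  Along the segment $t \mapsto \hat p + t X^a_{\mathrm{hb}}(\hat p)$, strong convexity and
  cocoercivity at $x_*$ give
  $\frac{d}{dt}V + \frac{\sqrt\mu}{4} V \le b^{\mathrm d}_{\mathrm{ET}} \le b^{\mathrm d}_{\mathrm{ST}}$.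
  Multiplying by $e^{\sqrt\mu\,t/4}$ and integrating up to the step, where $b^{\mathrm p} \le 0$ under
  either rule, shows that $V$ shrinks by $e^{-\sqrt\mu\,\Delta_k/4}$ in each iteration.

  For the stepsize bound, Young's inequality yields
  $b^{\mathrm d}_{\mathrm{ST}} \le q_v\,(t^2+2\nu_1 t-\eta_1)\|\hat v\|^2
     + q_g\,(t^2+2\nu_2 t-\eta_2)\|\nabla f(\hat x)\|^2$, and both brackets are negative for
  $0 \le t < \mathrm{MIET}(a)$. For $a \le a_2^*$ the numbers $\eta_1,\eta_2$ are positive,
  so the inner loop stops at the latest when $a$ has dropped below $a_2^*$.
\<close>

section \<open>Preliminaries\<close>

text \<open>Makes the \<open>THE\<close> in \<open>grad\<close> meaningful. In finite dimension the
  derivative is represented by the vector with coordinates \<open>D b\<close> on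
  \<open>Basis\<close>; testing uniqueness of the derivative on \<open>g' - g\<close> shows that
  there is no other.\<close>

lemma GDERIV_grad:
  fixes f :: "'a::euclidean_space \<Rightarrow> real"
  assumes "f differentiable (at x)"
  shows "GDERIV f x :> grad f x"
proof -
  obtain D where D: "(f has_derivative D) (at x)"
    using assms by (auto simp: differentiable_def)
  define g where "g = (\<Sum>b\<in>Basis. D b *\<^sub>R b)"
  have "D h = h \<bullet> g" for h
  proof -
    interpret D: bounded_linear D
      using D by (rule has_derivative_bounded_linear)
    have "D h = D (\<Sum>b\<in>Basis. (h \<bullet> b) *\<^sub>R b)"
      by (simp add: euclidean_representation)
    then show ?thesis
      by (simp add: D.sum D.scaleR g_def inner_sum_right mult.commute)
  qed
  then have "D = (\<lambda>h. h \<bullet> g)"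
    by (rule ext)
  with D have g: "GDERIV f x :> g"
    by (simp add: gderiv_def)
  have "g' = g" if "GDERIV f x :> g'" for g'
  proof -
    have "(\<lambda>h. h \<bullet> g') = (\<lambda>h. h \<bullet> g)"
      using that g has_derivative_unique unfolding gderiv_def by blast
    then have "(g' - g) \<bullet> (g' - g) = 0"
      by (metis inner_diff_right right_minus_eq)
    then show ?thesis
      by simp
  qed
  with g show ?thesis
    unfolding grad_def by (rule theI)
qed

lemma square_norm_add_le: "(norm (u + v))\<^sup>2 \<le> 2 * (norm u)\<^sup>2 + 2 * (norm (v::'a::real_inner))\<^sup>2"
proof -
  have "0 \<le> (norm (u - v))\<^sup>2"
    by simp
  then show ?thesis
    by (simp add: power2_norm_eq_inner inner_simps inner_commute algebra_simps)
qed

lemma inner_le_half_squares: "u \<bullet> v \<le> ((norm u)\<^sup>2 + (norm (v::'a::real_inner))\<^sup>2) / 2"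
proof -
  have "0 \<le> (norm (u - v))\<^sup>2"
    by simp
  then show ?thesis
    by (simp add: power2_norm_eq_inner inner_simps inner_commute algebra_simps)
qed

text \<open>A \<open>LEAST\<close> over the reals needs an attained minimum. Negativity on (0,
  \<delta>) keeps the zeros away from 0, so those in [\<delta>/2, T] form a compact set, nonempty by
  the intermediate value theorem; its least element is the first positive zero.\<close>

lemma LEAST_positive_zero:
  fixes \<phi> :: "real \<Rightarrow> real"
  assumes cont: "continuous_on {0..} \<phi>"
    and "0 < \<delta>" and neg: "\<And>t. 0 < t \<Longrightarrow> t < \<delta> \<Longrightarrow> \<phi> t < 0"
    and "0 < T" and "0 \<le> \<phi> T"
  defines "t \<equiv> LEAST t. t > 0 \<and> \<phi> t = 0"
  shows "0 < t" and "\<phi> t = 0" and "\<And>u. 0 < u \<Longrightarrow> u < t \<Longrightarrow> \<phi> u < 0"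
proof -
  have "\<delta> \<le> T"
    using neg[of T] assms by force
  \<comment> \<open>A nonnegative value at \<open>u\<close> forces a zero no later than
    \<open>u\<close>. This serves both the existence of a zero and the negativity before the first
    one.\<close>
  have IVT: "\<exists>z\<in>{\<delta>/2..u}. \<phi> z = 0" if "0 < u" "0 \<le> \<phi> u" for u
  proof -
    have "\<delta> \<le> u"
      using neg[of u] that by force
    then have "\<exists>z\<ge>\<delta>/2. z \<le> u \<and> \<phi> z = 0"
      using neg[of "\<delta>/2"] that \<open>0 < \<delta>\<close>
      by (intro IVT' continuous_on_subset[OF cont]) auto
    then show ?thesis
      by auto
  qed
  define Z where "Z = {z \<in> {\<delta>/2..T}. \<phi> z = 0}"
  have "continuous_on {\<delta>/2..T} \<phi>"
    using \<open>0 < \<delta>\<close> by (intro continuous_on_subset[OF cont]) auto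
  then have "closed Z"
    unfolding Z_def by (rule continuous_closed_preimage_constant) simp
  moreover have "bounded Z"
    by (rule bounded_subset[of "{\<delta>/2..T}"]) (auto simp: Z_def)
  ultimately have "compact Z"
    by (simp add: compact_eq_bounded_closed)
  moreover have "Z \<noteq> {}"
    using IVT[of T] assms by (auto simp: Z_def)
  ultimately obtain z where z: "z \<in> Z" "\<forall>y\<in>Z. z \<le> y"
    using compact_attains_inf by metis
  have least: "z \<le> y" if "0 < y \<and> \<phi> y = 0" for y
  proof (cases "y \<le> T")
    case True
    moreover have "\<delta>/2 \<le> y"
      using neg[of y] that \<open>0 < \<delta>\<close> by force
    ultimately show ?thesis
      using z that by (auto simp: Z_def)
  qed (use z in \<open>auto simp: Z_def\<close>)
  have t: "t = z"
    unfolding t_def using z least \<open>0 < \<delta>\<close> by (intro Least_equality) (auto simp: Z_def)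
  show "0 < t" "\<phi> t = 0"
    using z \<open>0 < \<delta>\<close> by (auto simp: t Z_def)
  show "\<phi> u < 0" if u: "0 < u" "u < t" for u
  proof (rule ccontr)
    assume "\<not> \<phi> u < 0"
    then obtain y where y: "y \<in> {\<delta>/2..u}" "\<phi> y = 0"
      using IVT[of u] u by auto
    then have "z \<le> y"
      using \<open>0 < \<delta>\<close> by (intro least) auto
    with y u show False
      by (auto simp: t)
  qed
qed

lemma quadratic_eventually_ge:
  fixes c d e K :: real
  assumes "0 < c"
  obtains T where "0 < T" and "\<And>t. T \<le> t \<Longrightarrow> K \<le> c * t\<^sup>2 + d * t + e"
proof
  \<comment> \<open>Beyond this \<open>T\<close>, \<open>c * t\<close> exceeds the sum of the
    absolute values, and \<open>t \<ge> 1\<close> lets the linear terms absorb the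
    constants.\<close>
  define T where "T = max 1 ((\<bar>d\<bar> + \<bar>e\<bar> + \<bar>K\<bar>) / c)"
  show "0 < T"
    by (simp add: T_def)
  fix t assume "T \<le> t"
  then have t: "1 \<le> t" "\<bar>d\<bar> + \<bar>e\<bar> + \<bar>K\<bar> \<le> c * t"
    using \<open>0 < c\<close> by (auto simp: T_def field_simps)
  then have "(\<bar>d\<bar> + \<bar>e\<bar> + \<bar>K\<bar>) * t \<le> c * t * t"
    by (intro mult_right_mono) auto
  moreover have "\<bar>e\<bar> * 1 \<le> \<bar>e\<bar> * t" "\<bar>K\<bar> * 1 \<le> \<bar>K\<bar> * t"
    using t by (intro mult_left_mono; simp)+
  moreover have "- (\<bar>d\<bar> * t) \<le> d * t"
    using t mult_right_mono[of "- \<bar>d\<bar>" d t] by auto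
  ultimately show "K \<le> c * t\<^sup>2 + d * t + e"
    by (simp add: power2_eq_square algebra_simps)
qed

declare A_ET.simps [simp del] B_ET.simps [simp del] C_ET.simps [simp del]
declare A_ST.simps [simp del] Bl_ST.simps [simp del] Bq_ST.simps [simp del]

section \<open>Smooth strongly convex functions\<close>

locale smooth_strongly_convex =
  fixes f :: "'a::euclidean_space \<Rightarrow> real" and \<mu> L s :: real and xstar :: 'a
  assumes mu_pos: "0 < \<mu>" and L_pos: "0 < L" and s_pos: "0 < s"
    and cont_diff: "cont_diff f"
    and strongly_convex: "strongly_convex \<mu> f"
    and lipschitz: "L-lipschitz_on UNIV (grad f)"
    and minimizer: "\<And>y. f xstar \<le> f y"
begin

abbreviation "r \<equiv> sqrt \<mu>"
abbreviation "m \<equiv> sqrt_mus \<mu> s"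

lemma r_pos: "0 < r" and r_squared: "r\<^sup>2 = \<mu>" and mu_powr: "\<mu> powr (3/2) = r * \<mu>"
  using mu_pos powr_add[of \<mu> 1 "1/2"] by (auto simp: powr_half_sqrt)

text \<open>Expressing both \<open>r\<close> and \<mu> through the single atom \<rho> turns later
  identities into ones that the simplifier can normalise.\<close>

lemma sqrt_mu_obtain:
  obtains \<rho> where "0 < \<rho>" and "r = \<rho>" and "\<mu> = \<rho> * \<rho>"
  using r_pos r_squared by (metis power2_eq_square)

lemma m_ge_1: "1 \<le> m"
  using mu_pos s_pos by (simp add: sqrt_mus_def)

lemma has_real_derivative_line:
  "((\<lambda>t. f (x + t *\<^sub>R v)) has_real_derivative grad f (x + t *\<^sub>R v) \<bullet> v) (at t within S)"
proof -
  have "f differentiable (at y)" for y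
    using cont_diff by (simp add: cont_diff_def differentiable_on_def)
  from GDERIV_grad[OF this] have *: "(f has_derivative (\<lambda>h. h \<bullet> grad f y)) (at y)" for y
    by (simp add: gderiv_def)
  have "((\<lambda>t. f (x + t *\<^sub>R v)) has_derivative (\<lambda>h. (h *\<^sub>R v) \<bullet> grad f (x + t *\<^sub>R v))) (at t within S)"
    by (rule has_derivative_compose[OF _ *]) (auto intro!: derivative_eq_intros)
  then show ?thesis
    by (simp add: has_field_derivative_def inner_commute mult.commute[of _ "inner _ _"] cong: if_cong)
qed

section \<open>First-order inequalities from strong convexity and the Lipschitz gradient\<close>

lemma convex_lower: "f x + grad f x \<bullet> (y - x) + \<mu> / 2 * (norm (y - x))\<^sup>2 \<le> f y"
  using strongly_convex unfolding strongly_convex_def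
  by (smt (verit, best) norm_minus_commute)

lemma grad_strongly_mono: "\<mu> * (norm (y - x))\<^sup>2 \<le> (grad f y - grad f x) \<bullet> (y - x)"
  using convex_lower[of x y] convex_lower[of y x]
  by (simp add: inner_simps norm_minus_commute algebra_simps)

lemma grad_lipschitz: "norm (grad f y - grad f x) \<le> L * norm (y - x)"
  using lipschitz_onD[OF lipschitz, of y x] by (simp add: dist_norm)

lemma grad_inner_lipschitz: "(grad f y - grad f x) \<bullet> (y - x) \<le> L * (norm (y - x))\<^sup>2"
proof -
  have "(grad f y - grad f x) \<bullet> (y - x) \<le> norm (grad f y - grad f x) * norm (y - x)"
    by (rule norm_cauchy_schwarz)
  also have "\<dots> \<le> L * norm (y - x) * norm (y - x)"
    by (intro mult_right_mono grad_lipschitz) simp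
  finally show ?thesis
    by (simp add: power2_eq_square)
qed

lemma grad_line_le: "0 \<le> t \<Longrightarrow> (grad f (x + t *\<^sub>R v) - grad f x) \<bullet> v \<le> L * t * (norm v)\<^sup>2"
  using grad_inner_lipschitz[of "x + t *\<^sub>R v" x] mult_le_cancel_left_pos[of t _ "L * t * (norm v)\<^sup>2"]
  by (cases "t = 0") (auto simp: power2_eq_square mult.left_commute mult.assoc)

lemma grad_line_ge: "0 \<le> t \<Longrightarrow> \<mu> * t * (norm v)\<^sup>2 \<le> (grad f (x + t *\<^sub>R v) - grad f x) \<bullet> v"
  using grad_strongly_mono[of "x + t *\<^sub>R v" x] mult_le_cancel_left_pos[of t "\<mu> * t * (norm v)\<^sup>2"]
  by (cases "t = 0") (auto simp: power2_eq_square mult.left_commute mult.assoc)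

text \<open>The lower and upper bounds on the gradient increment, compared along a unit basis
  vector. This is what makes \<open>beta5\<close> positive.\<close>

lemma mu_le_L: "\<mu> \<le> L"
proof -
  obtain b :: 'a where "b \<in> Basis"
    using nonempty_Basis by blast
  then show ?thesis
    using grad_line_le[of 1 0 b] grad_line_ge[of 1 b 0] by simp
qed

lemma descent: "f (x + v) \<le> f x + grad f x \<bullet> v + L / 2 * (norm v)\<^sup>2"
proof -
  \<comment> \<open>Chosen so that \<open>?\<phi> 1 \<le> ?\<phi> 0\<close> is the claim, while
    \<open>grad_line_le\<close> makes the derivative nonpositive on [0, 1].\<close>
  let ?\<phi> = "\<lambda>t. f (x + t *\<^sub>R v) - t * (grad f x \<bullet> v) - t\<^sup>2 * (L / 2 * (norm v)\<^sup>2)"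
  have "?\<phi> 1 \<le> ?\<phi> 0"
  proof (rule DERIV_nonpos_imp_nonincreasing[of 0 1 ?\<phi>])
    fix t :: real assume "0 \<le> t"
    have "(?\<phi> has_real_derivative
        grad f (x + t *\<^sub>R v) \<bullet> v - grad f x \<bullet> v - 2 * t * (L / 2 * (norm v)\<^sup>2)) (at t)"
      by (rule derivative_eq_intros has_real_derivative_line refl | simp)+
    moreover have "grad f (x + t *\<^sub>R v) \<bullet> v - grad f x \<bullet> v - 2 * t * (L / 2 * (norm v)\<^sup>2) \<le> 0"
      using grad_line_le[OF \<open>0 \<le> t\<close>, of x v] by (simp add: inner_diff_left algebra_simps)
    ultimately show "\<exists>y. (?\<phi> has_real_derivative y) (at t) \<and> y \<le> 0"
      by blast
  qed simp
  then show ?thesis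
    by simp
qed

lemma grad_gap: "(norm (grad f x))\<^sup>2 / (2 * L) \<le> f x - f xstar"
proof -
  \<comment> \<open>The gradient step with factor 1/L minimises the quadratic majorant given by
    \<open>descent\<close>.\<close>
  let ?v = "- (1 / L) *\<^sub>R grad f x"
  have "f xstar \<le> f x + grad f x \<bullet> ?v + L / 2 * (norm ?v)\<^sup>2"
    using minimizer descent[of x ?v] by (rule order_trans)
  then show ?thesis
    using L_pos by (simp add: dot_square_norm power_divide field_simps power2_eq_square)
qed

lemma grad_minimizer: "grad f xstar = 0"
  using grad_gap[of xstar] L_pos by (simp add: divide_le_0_iff)

text \<open>The tangent bound at \<open>z\<close> and the descent bound at \<open>xstar\<close>,
  compared at the point \<open>xstar + ?v\<close>, give half of the left side plus the gap
  \<open>f z - f xstar\<close>; \<open>grad_gap\<close> turns this gap into the other half.\<close>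

lemma cocoercive_minimizer: "(norm (grad f z))\<^sup>2 / L \<le> grad f z \<bullet> (z - xstar)"
proof -
  let ?v = "(1 / L) *\<^sub>R grad f z"
  have "f z + grad f z \<bullet> (xstar + ?v - z) \<le> f (xstar + ?v)"
    using convex_lower[of z "xstar + ?v"] mu_pos
    by (smt (verit) mult_nonneg_nonneg zero_le_power2 divide_nonneg_nonneg)
  also have "\<dots> \<le> f xstar + L / 2 * (norm ?v)\<^sup>2"
    using descent[of xstar ?v] by (simp add: grad_minimizer)
  also have "L / 2 * (norm ?v)\<^sup>2 = (norm (grad f z))\<^sup>2 / L / 2"
    using L_pos by (simp add: power2_eq_square)
  finally show ?thesis
    using grad_gap[of z] by (simp add: dot_square_norm inner_simps)
qed

lemma grad_norm_le: "norm (grad f x) \<le> L * norm (x - xstar)"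
  using grad_lipschitz[of x xstar] by (simp add: grad_minimizer)

lemma grad_norm_ge: "\<mu> * norm (x - xstar) \<le> norm (grad f x)"
proof (cases "x = xstar")
  case False
  have "\<mu> * (norm (x - xstar))\<^sup>2 \<le> norm (grad f x) * norm (x - xstar)"
    using grad_strongly_mono[of x xstar] norm_cauchy_schwarz[of "grad f x" "x - xstar"]
    by (simp add: grad_minimizer)
  with False show ?thesis
    by (simp add: power2_eq_square)
qed simp


section \<open>The Lyapunov function along a step\<close>

definition lyap :: "'a \<times> 'a \<Rightarrow> real" where
  "lyap p = m * (f (fst p) - f xstar) + (norm (snd p))\<^sup>2 / 4
     + (norm (snd p + (2 * r) *\<^sub>R (fst p - xstar)))\<^sup>2 / 4"

lemma suboptimality_le_lyap: "f (fst p) - f xstar \<le> lyap p"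
proof -
  have "1 * (f (fst p) - f xstar) \<le> m * (f (fst p) - f xstar)"
    using minimizer m_ge_1 by (intro mult_right_mono) auto
  then show ?thesis
    by (simp add: lyap_def add_increasing2)
qed

lemma norm_damped_force:
  "(norm ((2 * r) *\<^sub>R v + m *\<^sub>R g))\<^sup>2
     = 4 * \<mu> * (norm v)\<^sup>2 + 4 * r * m * (g \<bullet> v) + m\<^sup>2 * (norm g)\<^sup>2"
  for v g :: 'a
  using mu_pos unfolding power2_norm_eq_inner
  by (simp add: inner_simps inner_commute algebra_simps power2_eq_square)

text \<open>An exact expansion: apart from \<open>f (x + t *\<^sub>R v)\<close> it is quadratic in
  \<open>t\<close>, so the derivative can be read off and split into its value at 0 and its
  increase.\<close>

lemma lyap_X_hb:
  fixes x v :: 'a and a t :: real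
  defines "g \<equiv> grad f (x + a *\<^sub>R v)"
  shows "lyap ((x, v) + t *\<^sub>R X_hb f \<mu> s a (x, v)) = lyap (x, v) + m * (f (x + t *\<^sub>R v) - f x)
      + t\<^sup>2 * (((norm ((2 * r) *\<^sub>R v + m *\<^sub>R g))\<^sup>2 + m\<^sup>2 * (norm g)\<^sup>2) / 4)
      - t * (r * (norm v)\<^sup>2 + m * (g \<bullet> v) + r * m * (g \<bullet> (x - xstar)))"
proof -
  define w where "w = (2 * r) *\<^sub>R v + m *\<^sub>R g"
  define q where "q = v + (2 * r) *\<^sub>R (x - xstar)"
  have X: "X_hb f \<mu> s a (x, v) = (v, - w)"
    by (simp add: w_def g_def)
  \<comment> \<open>The friction in the velocity cancels the drift \<open>2 r v\<close> of the
    position, so the last square moves only along \<open>g\<close>.\<close>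
  have "v - t *\<^sub>R w + (2 * r) *\<^sub>R (x + t *\<^sub>R v - xstar) = q - (t * m) *\<^sub>R g"
    by (simp add: q_def w_def algebra_simps)
  then have "lyap ((x, v) + t *\<^sub>R X_hb f \<mu> s a (x, v)) = m * (f (x + t *\<^sub>R v) - f xstar)
      + (norm (v - t *\<^sub>R w))\<^sup>2 / 4 + (norm (q - (t * m) *\<^sub>R g))\<^sup>2 / 4"
    unfolding X by (simp add: lyap_def)
  moreover have "lyap (x, v) = m * (f x - f xstar) + (norm v)\<^sup>2 / 4 + (norm q)\<^sup>2 / 4"
    by (simp add: lyap_def q_def)
  moreover have "(norm (v - t *\<^sub>R w))\<^sup>2 = (norm v)\<^sup>2 - 2 * t * (w \<bullet> v) + t\<^sup>2 * (norm w)\<^sup>2"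
    unfolding power2_norm_eq_inner
    by (simp add: inner_simps inner_commute algebra_simps power2_eq_square)
  moreover have "(norm (q - (t * m) *\<^sub>R g))\<^sup>2 = (norm q)\<^sup>2 - 2 * t * m * (g \<bullet> q) + t\<^sup>2 * m\<^sup>2 * (norm g)\<^sup>2"
    unfolding power2_norm_eq_inner
    by (simp add: inner_simps inner_commute algebra_simps power2_eq_square)
  moreover have "w \<bullet> v = 2 * r * (norm v)\<^sup>2 + m * (g \<bullet> v)"
    unfolding power2_norm_eq_inner by (simp add: w_def inner_simps)
  moreover have "g \<bullet> q = g \<bullet> v + 2 * r * (g \<bullet> (x - xstar))"
    by (simp add: q_def inner_simps)
  ultimately show ?thesis
    unfolding w_def[symmetric] by (simp only:) (simp add: field_simps)
qed

text \<open>The left side is the derivative of \<open>lyap\<close> at t = 0 plus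
  \<open>r / 4 * lyap\<close>. Strong convexity from the displaced point towards
  \<open>xstar\<close> bounds \<open>- (g \<bullet> (x - xstar))\<close> by a negative function gap
  and a negative multiple of the squared distance. The added quarter of \<open>lyap\<close> leaves
  three quarters of the gap, the factor \<open>m - 1\<close> on the distance term, and -1 + 3/16 =
  -13/16 on |v|^2. The first two are then estimated through \<open>grad f x\<close>.\<close>

lemma lyap_deriv_initial_le_C_ET:
  fixes x v :: 'a
  assumes "0 \<le> a"
  defines "g \<equiv> grad f (x + a *\<^sub>R v)"
  shows "m * (grad f x \<bullet> v) - (r * (norm v)\<^sup>2 + m * (g \<bullet> v) + r * m * (g \<bullet> (x - xstar)))
      + r / 4 * lyap (x, v) \<le> C_ET f \<mu> L s (x, v) a"
proof -
  define u where "u = x - xstar"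
  define y where "y = norm (grad f x)"
  define Y1 Y2 where "Y1 = y\<^sup>2 / (2 * L)" and "Y2 = y\<^sup>2 / L\<^sup>2"
  \<comment> \<open>Doubling the squares in the mixed term gives 1/4 + 2/4 = 3/4 on |v|^2 and 2 * 4
    \<mu> / 4 = 2 \<mu> on |u|^2.\<close>
  have lyap: "lyap (x, v) \<le> m * (f x - f xstar) + 3/4 * (norm v)\<^sup>2 + 2 * \<mu> * (norm u)\<^sup>2"
    using square_norm_add_le[of v "(2 * r) *\<^sub>R u"] mu_pos
    by (simp add: lyap_def u_def power_mult_distrib)
  have lower: "f (x + a *\<^sub>R v) - g \<bullet> u - a * (g \<bullet> v)
      + \<mu> / 2 * ((norm u)\<^sup>2 + 2 * a * (u \<bullet> v) + a\<^sup>2 * (norm v)\<^sup>2) \<le> f xstar"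
  proof -
    have "(norm (xstar - (x + a *\<^sub>R v)))\<^sup>2 = (norm u)\<^sup>2 + 2 * a * (u \<bullet> v) + a\<^sup>2 * (norm v)\<^sup>2"
      unfolding power2_norm_eq_inner
      by (simp add: u_def inner_simps inner_commute algebra_simps power2_eq_square)
    moreover have "g \<bullet> (xstar - (x + a *\<^sub>R v)) = - (g \<bullet> u) - a * (g \<bullet> v)"
      by (simp add: u_def inner_simps)
    ultimately show ?thesis
      using convex_lower[of "x + a *\<^sub>R v" xstar] by (simp add: g_def)
  qed
  \<comment> \<open>The cross term from expanding the squared distance contains the unknown
    \<open>xstar\<close>; strong monotonicity trades \<mu> |u| for the computable
    \<open>y\<close>.\<close>
  have "- (\<mu> * (u \<bullet> v)) \<le> \<mu> * norm u * norm v"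
    using mult_left_mono[OF norm_cauchy_schwarz[of "- u" v], of \<mu>] mu_pos
    by (simp add: mult.assoc)
  also have "\<dots> \<le> y * norm v"
    using grad_norm_ge by (intro mult_right_mono) (auto simp: y_def u_def)
  finally have "a * (- (\<mu> * (u \<bullet> v))) \<le> a * (y * norm v)"
    using assms by (intro mult_left_mono)
  with lower have lower': "f (x + a *\<^sub>R v) - g \<bullet> u - a * (g \<bullet> v) + \<mu> / 2 * (norm u)\<^sup>2
      - a * (y * norm v) + \<mu> / 2 * (a\<^sup>2 * (norm v)\<^sup>2) \<le> f xstar"
    by (simp add: algebra_simps)
  have gap: "Y1 \<le> f x - f xstar"
    unfolding Y1_def y_def by (rule grad_gap)
  have "y \<le> L * norm u"
    unfolding y_def u_def by (rule grad_norm_le)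
  then have "y\<^sup>2 \<le> L\<^sup>2 * (norm u)\<^sup>2"
    unfolding power_mult_distrib[symmetric] by (rule power_mono) (simp add: y_def)
  then have "Y2 \<le> (norm u)\<^sup>2"
    using L_pos by (simp add: Y2_def field_simps)
  then have dist: "\<mu> / 2 * (m - 1) * Y2 \<le> \<mu> / 2 * (m - 1) * (norm u)\<^sup>2"
    using mu_pos m_ge_1 by (intro mult_left_mono) auto
  have "m * (f (x + a *\<^sub>R v) - g \<bullet> u - a * (g \<bullet> v) + \<mu> / 2 * (norm u)\<^sup>2
      - a * (y * norm v) + \<mu> / 2 * (a\<^sup>2 * (norm v)\<^sup>2)) \<le> m * f xstar"
    using lower' m_ge_1 by (intro mult_left_mono) auto
  moreover have "3 / 4 * m * Y1 \<le> 3 / 4 * m * (f x - f xstar)"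
    using gap m_ge_1 by (intro mult_left_mono) auto
  ultimately have "- m * (g \<bullet> u) + m / 4 * (f x - f xstar) + \<mu> / 2 * (norm u)\<^sup>2
    \<le> - \<mu> / 2 * (m - 1) * Y2 - 3 / 4 * m * Y1
      + m * (f x - f (x + a *\<^sub>R v)) + m * (a * (y * norm v)) - m * (\<mu> / 2 * (a\<^sup>2 * (norm v)\<^sup>2))
      + m * (a * (g \<bullet> v))" (is "?lhs \<le> ?rhs")
    using dist by (simp add: algebra_simps) (simp add: field_simps)
  then have "r * ?lhs \<le> r * ?rhs"
    using r_pos by (intro mult_left_mono) auto
  moreover have "r / 4 * lyap (x, v)
      \<le> r / 4 * (m * (f x - f xstar) + 3/4 * (norm v)\<^sup>2 + 2 * \<mu> * (norm u)\<^sup>2)"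
    using lyap r_pos by (intro mult_left_mono) auto
  \<comment> \<open>Here \<open>m - 1 = sqrt (\<mu> * s)\<close>, and its factor
    \<open>sqrt \<mu>\<close> combines with \<open>r\<close> to give \<mu>.\<close>
  moreover have s: "\<mu>\<^sup>2 * sqrt s / 2 * Y2 = r * (\<mu> / 2 * (m - 1) * Y2)"
    using mu_pos by (simp add: sqrt_mus_def real_sqrt_mult power2_eq_square algebra_simps)
  moreover have y: "- (3 * r / (8 * L)) * y\<^sup>2 = - 3 / 4 * (r * Y1)"
    by (simp add: Y1_def)
  moreover have av: "norm (a *\<^sub>R v) = a * norm v"
    using assms by simp
  ultimately show ?thesis
    unfolding C_ET.simps Let_def g_def[symmetric] y_def[symmetric] u_def[symmetric]
      mu_powr Y2_def[symmetric]
    unfolding s y av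
    by (simp add: inner_diff_left power_mult_distrib algebra_simps) (simp add: field_simps)
qed


text \<open>The left side splits into the increase of the derivative since t = 0, equal to
  \<open>A_ET\<close>; r/4 times the increase of \<open>lyap\<close>, at most \<open>B_ET\<close>;
  and the value of the whole expression at t = 0, at most \<open>C_ET\<close>.\<close>

lemma lyap_rate_le_b_ET:
  fixes x v :: 'a
  assumes "0 \<le> a" and "0 \<le> t"
  obtains D where "((\<lambda>t. lyap ((x, v) + t *\<^sub>R X_hb f \<mu> s a (x, v))) has_real_derivative D) (at t)"
    and "D + r / 4 * lyap ((x, v) + t *\<^sub>R X_hb f \<mu> s a (x, v)) \<le> b_d ET f \<mu> L s (x, v) t a"
proof -
  obtain \<rho> where \<rho>: "r = \<rho>" and mu: "\<mu> = \<rho> * \<rho>"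
    by (rule sqrt_mu_obtain)
  define M where "M = m"
  define g where "g = grad f (x + a *\<^sub>R v)"
  define W where "W = (norm ((2 * r) *\<^sub>R v + m *\<^sub>R g))\<^sup>2"
  define Q where "Q = (W + m\<^sup>2 * (norm g)\<^sup>2) / 4"
  define R where "R = r * (norm v)\<^sup>2 + m * (g \<bullet> v) + r * m * (g \<bullet> (x - xstar))"
  define D where "D = m * (grad f (x + t *\<^sub>R v) \<bullet> v) + 2 * t * Q - R"
  note lyap = lyap_X_hb[of x v _ a, folded g_def, folded W_def, folded Q_def R_def]
  have "((\<lambda>t. lyap ((x, v) + t *\<^sub>R X_hb f \<mu> s a (x, v))) has_real_derivative D) (at t)"
    unfolding lyap D_def by (rule derivative_eq_intros has_real_derivative_line refl | simp)+
  moreover have "D + r / 4 * lyap ((x, v) + t *\<^sub>R X_hb f \<mu> s a (x, v)) \<le> b_d ET f \<mu> L s (x, v) t a"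
  proof -
    have C: "m * (grad f x \<bullet> v) - R + r / 4 * lyap (x, v) \<le> C_ET f \<mu> L s (x, v) a"
      unfolding R_def g_def by (rule lyap_deriv_initial_le_C_ET[OF assms(1)])
    have A: "A_ET f \<mu> s (x, v) t a = m * ((grad f (x + t *\<^sub>R v) - grad f x) \<bullet> v) + 2 * t * Q"
      unfolding A_ET.simps Let_def g_def[symmetric] Q_def W_def norm_damped_force
      by (simp add: field_simps power2_eq_square)
    define G where "G = (norm g)\<^sup>2 / L"
    have G: "t * r / L * (norm g)\<^sup>2 = t * r * G"
      by (simp add: G_def)
    \<comment> \<open>Cocoercivity at the displaced point removes \<open>xstar\<close> from the term
      linear in \<open>t\<close>.\<close>
    have "G - a * (v \<bullet> g) \<le> g \<bullet> (x - xstar)"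
      using cocoercive_minimizer[of "x + a *\<^sub>R v", folded g_def, folded G_def]
      by (simp add: inner_simps inner_commute)
    then have "t * \<mu> * m / 4 * (G - a * (v \<bullet> g)) \<le> t * \<mu> * m / 4 * (g \<bullet> (x - xstar))"
      using assms mu_pos m_ge_1 by (intro mult_left_mono) auto
    then have B: "r / 4 * (m * (f (x + t *\<^sub>R v) - f x) + t\<^sup>2 * Q - t * R) \<le> B_ET f \<mu> L s (x, v) t a"
      unfolding B_ET.simps Let_def g_def[symmetric] W_def[symmetric] R_def Q_def G
      unfolding \<rho> M_def[symmetric]
      unfolding mu by (simp add: field_simps inner_commute power2_eq_square)
    have "D + r / 4 * lyap ((x, v) + t *\<^sub>R X_hb f \<mu> s a (x, v))
      = m * ((grad f (x + t *\<^sub>R v) - grad f x) \<bullet> v) + 2 * t * Q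
        + r / 4 * (m * (f (x + t *\<^sub>R v) - f x) + t\<^sup>2 * Q - t * R)
        + (m * (grad f x \<bullet> v) - R + r / 4 * lyap (x, v))"
      unfolding lyap D_def inner_diff_left by algebra
    also have "\<dots> \<le> b_d ET f \<mu> L s (x, v) t a"
      unfolding b_d.simps A by (intro add_mono order_refl B C)
    finally show ?thesis .
  qed
  ultimately show ?thesis
    by (rule that)
qed

text \<open>The two quantities that need evaluation along the segment are replaced by bounds from
  the current point: the gradient increment by \<open>grad_line_le\<close>, the function increment
  by \<open>descent\<close>.\<close>

lemma b_ET_le_b_ST:
  assumes "0 \<le> t"
  shows "b_d ET f \<mu> L s p t a \<le> b_d ST f \<mu> L s p t a"
proof -
  obtain x v where p: "p = (x, v)"
    by (cases p)
  obtain \<rho> where \<rho>: "r = \<rho>" and mu: "\<mu> = \<rho> * \<rho>"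
    by (rule sqrt_mu_obtain)
  define M where "M = m"
  define g where "g = grad f (x + a *\<^sub>R v)"
  have "m * ((grad f (x + t *\<^sub>R v) - grad f x) \<bullet> v) \<le> m * (L * t * (norm v)\<^sup>2)"
    using grad_line_le[OF assms] m_ge_1 by (intro mult_left_mono) auto
  then have A: "A_ET f \<mu> s p t a \<le> A_ST f \<mu> L s p a * t"
    unfolding p A_ET.simps A_ST.simps Let_def g_def[symmetric] by (simp add: algebra_simps)
  have "f (x + t *\<^sub>R v) - f x \<le> t * (grad f x \<bullet> v) + L / 2 * t\<^sup>2 * (norm v)\<^sup>2"
    using descent[of x "t *\<^sub>R v"] by (simp add: power_mult_distrib)
  then have "r * m / 4 * (f (x + t *\<^sub>R v) - f x)
      \<le> r * m / 4 * (t * (grad f x \<bullet> v) + L / 2 * t\<^sup>2 * (norm v)\<^sup>2)"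
    using r_pos m_ge_1 by (intro mult_left_mono) auto
  then have B: "B_ET f \<mu> L s p t a \<le> Bq_ST f \<mu> L s p a * t\<^sup>2 + Bl_ST f \<mu> L s p a * t"
    unfolding p B_ET.simps Bq_ST.simps Bl_ST.simps Let_def g_def[symmetric] \<rho> M_def[symmetric]
    unfolding mu by (simp add: field_simps inner_simps inner_commute power2_eq_square)
  show ?thesis
    using A B by (simp add: C_ST_def algebra_simps)
qed

text \<open>With the next lemma, both triggers lie between the ET and the ST function, so upper
  bounds are proved for ST and lower bounds for ET only.\<close>

lemma b_d_le_b_ST: "0 \<le> t \<Longrightarrow> b_d h f \<mu> L s p t a \<le> b_d ST f \<mu> L s p t a"
  by (cases h) (use b_ET_le_b_ST in auto)

lemma b_ET_le_b_d: "0 \<le> t \<Longrightarrow> b_d ET f \<mu> L s p t a \<le> b_d h f \<mu> L s p t a"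
  by (cases h) (use b_ET_le_b_ST in auto)


section \<open>The minimum inter-event time\<close>

text \<open>The leading coefficients $q_v$, $q_g$ above; up to monomials in $L$, $\sqrt\mu$, $\sqrt{\mu_s}$ they
  are the denominators of $\eta_1,\nu_1$ and $\eta_2,\nu_2$.\<close>

definition qv :: "real \<Rightarrow> real" where
  "qv a = r * (m * L * (3 * a\<^sup>2 * m * L + 1) + 4 * \<mu>) / 8"

definition qg :: real where
  "qg = 3 * r * m\<^sup>2 / 8"

section \<open>Signs of the constants and identities between them\<close>

lemma qv_pos: "0 < qv a"
proof -
  have "0 \<le> m * L * (3 * a\<^sup>2 * m * L + 1)"
    using L_pos m_ge_1 by simp
  then show ?thesis
    using mu_pos r_pos by (simp add: qv_def)
qed

lemma qg_pos: "0 < qg"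
  using r_pos m_ge_1 by (simp add: qg_def)

lemma beta1_pos: "0 < beta1 \<mu> L s"
  using m_ge_1 r_pos L_pos by (simp add: beta1_def add_pos_pos)

lemma beta2_pos: "0 < beta2 \<mu> s"
  using m_ge_1 r_pos by (simp add: beta2_def)

lemma beta3_pos: "0 < beta3 \<mu>"
  using r_pos by (simp add: beta3_def)

lemma beta4_pos: "0 < beta4 \<mu> L s"
  using m_ge_1 r_pos L_pos mu_pos s_pos by (simp add: beta4_def add_pos_pos)

lemma beta5_pos: "0 < beta5 \<mu> L s"
proof -
  have "r * \<mu> \<le> r * L"
    using mu_le_L r_pos by simp
  moreover have "0 < r * L"
    using r_pos L_pos by simp
  ultimately have "0 < 5 * r * L / 2 - r * \<mu> / 2"
    by simp
  then show ?thesis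
    using m_ge_1 by (simp add: beta5_def mu_powr)
qed

text \<open>Clearing the denominator shows where \<open>a2_star\<close> comes from: its first
  candidate is the positive root of this quadratic in \<open>a\<close>, and its second is the root
  of the linear expression in \<open>qg_eta2\<close>.\<close>

lemma qv_eta1: "qv a * eta1 \<mu> L s a = beta3 \<mu> - a * beta1 \<mu> L s - a\<^sup>2 * beta5 \<mu> L s"
proof -
  obtain \<rho> where \<rho>: "0 < \<rho>" "r = \<rho>" and mu: "\<mu> = \<rho> * \<rho>"
    by (rule sqrt_mu_obtain)
  define D where "D = m * L * (3 * a\<^sup>2 * m * L + 1) + 4 * \<mu>"
  have eta1: "eta1 \<mu> L s a = (8 * a * m * (a * (\<mu> - 5 * L) - 2 * L / r - 3) + 13) / (2 * D)"
    by (simp add: eta1_def D_def algebra_simps)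
  have qv: "qv a = r * D / 8"
    by (simp add: qv_def D_def)
  then have "D \<noteq> 0"
    using qv_pos[of a] r_pos by auto
  then have qv_eta1: "qv a * eta1 \<mu> L s a = r * (8 * a * m * (a * (\<mu> - 5 * L) - 2 * L / r - 3) + 13) / 16"
    unfolding eta1 qv by simp
  define M where "M = m"
  show ?thesis
    unfolding qv_eta1 beta3_def beta1_def beta5_def mu_powr \<rho>(2) M_def[symmetric]
    unfolding mu using \<rho>(1) by (simp add: field_simps power2_eq_square)
qed

lemma qg_eta2: "qg * eta2 \<mu> L s a = beta4 \<mu> L s - a * beta2 \<mu> s"
  using r_pos m_ge_1 L_pos
  by (simp add: qg_def eta2_def beta4_def beta2_def mus_def field_simps power2_eq_square)

text \<open>The polynomial is the coefficient of |v|^2 to which the estimate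
  \<open>A_Bl_ST_le\<close> leads; \<open>qg_nu2\<close> does the same for the gradient.\<close>

lemma qv_nu1: "2 * qv a * nu1 \<mu> L s a = 2 * \<mu> + m * L + r * m + 2 * r * m * a\<^sup>2 * L\<^sup>2
    + 2 * m\<^sup>2 * a\<^sup>2 * L\<^sup>2 + r * m * a * L / 4 + a * \<mu> * m / 8 + \<mu> * m * a ^ 3 * L\<^sup>2 / 4"
proof -
  define D where "D = m * L * (3 * a\<^sup>2 * m * L + 1) + 4 * \<mu>"
  have qv: "qv a = r * D / 8"
    by (simp add: qv_def D_def)
  then have "D \<noteq> 0"
    using qv_pos[of a] r_pos by auto
  then have qv_nu1: "2 * qv a * (p / (2 * r * D) + q / D) = p / 8 + r * q / 4" for p q
    unfolding qv using r_pos by (simp add: field_simps)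
  then show ?thesis
    unfolding nu1_def D_def[symmetric] qv_nu1
    by (simp add: algebra_simps add_divide_distrib power2_eq_square power3_eq_cube)
qed

lemma qg_nu2: "2 * qg * nu2 \<mu> s a = 2 * m\<^sup>2 + 2 * r * m + a * \<mu> * m / 4"
  using r_pos m_ge_1 by (simp add: qg_def nu2_def field_simps power2_eq_square)

text \<open>Makes the maximum \<nu> in \<open>MIET\<close> nonnegative.\<close>

lemma nu2_nonneg: "0 \<le> a \<Longrightarrow> 0 \<le> nu2 \<mu> s a"
  using r_pos m_ge_1 mu_pos by (simp add: nu2_def)

text \<open>Convexity, Cauchy-Schwarz and the Lipschitz bound leave three copies of the product of
  \<open>norm (grad f x)\<close> and \<open>norm v\<close>. Splitting it evenly into squares gives
  the 3/2 in both \<open>beta1\<close> and \<open>beta2\<close>.\<close>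

lemma C_ET_le:
  assumes "0 \<le> a"
  shows "C_ET f \<mu> L s (x, v) a \<le> - (beta3 \<mu> - a * beta1 \<mu> L s - a\<^sup>2 * beta5 \<mu> L s) * (norm v)\<^sup>2
    - (beta4 \<mu> L s - a * beta2 \<mu> s) * (norm (grad f x))\<^sup>2"
proof -
  define g where "g = grad f (x + a *\<^sub>R v)"
  define V Y where "V = (norm v)\<^sup>2" and "Y = (norm (grad f x))\<^sup>2"
  have yv: "norm (grad f x) * norm v \<le> (V + Y) / 2"
    using arith_geo_mean_sqrt[of V Y] by (simp add: V_def Y_def real_sqrt_mult mult.commute)
  have fx: "f x - f (x + a *\<^sub>R v) \<le> a * (norm (grad f x) * norm v)"
  proof -
    have "f x + a * (grad f x \<bullet> v) \<le> f (x + a *\<^sub>R v)"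
    proof -
      have "0 \<le> \<mu> / 2 * (norm (a *\<^sub>R v))\<^sup>2"
        using mu_pos by simp
      then show ?thesis
        using convex_lower[of x "x + a *\<^sub>R v"] by (simp del: norm_scaleR)
    qed
    moreover have "a * ((- grad f x) \<bullet> v) \<le> a * (norm (grad f x) * norm v)"
      using norm_cauchy_schwarz[of "- grad f x" v] assms by (intro mult_left_mono) auto
    ultimately show ?thesis
      by simp
  qed
  have gv: "(g - grad f x) \<bullet> v \<le> L * a * V"
    unfolding V_def g_def by (rule grad_line_le[OF assms])
  have gv_nonneg: "0 \<le> (g - grad f x) \<bullet> v"
    using grad_line_ge[OF assms, of v x] mu_pos assms unfolding g_def
    by (smt (verit) mult_nonneg_nonneg zero_le_power2)
  have "g \<bullet> v \<le> L * a * V + norm (grad f x) * norm v"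
    using gv norm_cauchy_schwarz[of "grad f x" v] by (simp add: inner_diff_left)
  from mult_left_mono[OF this assms] fx
  have "f x - f (x + a *\<^sub>R v) + norm (grad f x) * norm (a *\<^sub>R v) + g \<bullet> (a *\<^sub>R v)
      \<le> 3 * a * (norm (grad f x) * norm v) + L * a\<^sup>2 * V"
    using assms by (simp add: algebra_simps power2_eq_square)
  \<comment> \<open>The factor on \<open>L * a\<^sup>2 * V\<close> is enlarged to the 5/2 that
    occurs in \<open>beta5\<close>.\<close>
  also have "\<dots> \<le> 3 * a * ((V + Y) / 2) + 5 / 2 * L * a\<^sup>2 * V"
    using yv assms L_pos by (intro add_mono mult_left_mono mult_right_mono) (auto simp: V_def)
  finally have "m * (r * (f x - f (x + a *\<^sub>R v) + norm (grad f x) * norm (a *\<^sub>R v) + g \<bullet> (a *\<^sub>R v)))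
      \<le> m * (r * (3 * a * ((V + Y) / 2) + 5 / 2 * L * a\<^sup>2 * V))"
    using r_pos m_ge_1 by (intro mult_left_mono) auto
  \<comment> \<open>The gradient increment enters \<open>C_ET\<close> negatively and is bounded by
    0; the nonnegative \<open>a * m * L * V\<close> is given away to reach
    \<open>beta1\<close>.\<close>
  moreover have "0 \<le> m * ((g - grad f x) \<bullet> v) + a * m * L * V"
    using gv_nonneg m_ge_1 assms L_pos by (simp add: V_def)
  moreover have "beta4 \<mu> L s * Y = \<mu>\<^sup>2 * sqrt s / 2 * (Y / L\<^sup>2) + m * ((3 * r / (8 * L)) * Y)"
    using L_pos by (simp add: beta4_def field_simps power2_eq_square)
  moreover have "(norm (a *\<^sub>R v))\<^sup>2 = a\<^sup>2 * V"
    by (simp add: power_mult_distrib V_def)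
  moreover have rhs: "- (beta3 \<mu> - a * beta1 \<mu> L s - a\<^sup>2 * beta5 \<mu> L s) * V
      - (beta4 \<mu> L s - a * beta2 \<mu> s) * Y
    = m * (r * (3 * a * ((V + Y) / 2) + 5 / 2 * L * a\<^sup>2 * V)) + a * m * L * V
      - beta4 \<mu> L s * Y - beta3 \<mu> * V - m * (r * \<mu> / 2 * (a\<^sup>2 * V))"
    by (simp add: beta1_def beta2_def beta5_def mu_powr algebra_simps)
  moreover have "C_ET f \<mu> L s (x, v) a = m * (r * (f x - f (x + a *\<^sub>R v)
      + norm (grad f x) * norm (a *\<^sub>R v) + g \<bullet> (a *\<^sub>R v)))
    - m * ((g - grad f x) \<bullet> v) - \<mu>\<^sup>2 * sqrt s / 2 * (Y / L\<^sup>2) - m * ((3 * r / (8 * L)) * Y)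
    - beta3 \<mu> * V - m * (r * \<mu> / 2 * (a\<^sup>2 * V))"
    unfolding C_ET.simps Let_def g_def[symmetric] V_def[symmetric] Y_def[symmetric] mu_powr
      beta3_def power_mult_distrib norm_scaleR power2_abs
    by (simp add: algebra_simps)
  ultimately show ?thesis
    unfolding V_def[symmetric] Y_def[symmetric] rhs by linarith
qed


text \<open>Replaces the displaced gradient by the one at \<open>x\<close>, so that all later bounds
  are combinations of the same two squares.\<close>

lemma displaced_grad_norm_le:
  assumes "0 \<le> a"
  shows "(norm (grad f (x + a *\<^sub>R v)))\<^sup>2 \<le> 2 * (norm (grad f x))\<^sup>2 + 2 * (L\<^sup>2 * a\<^sup>2 * (norm v)\<^sup>2)"
proof -
  have "norm (grad f (x + a *\<^sub>R v) - grad f x) \<le> L * a * norm v"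
    using grad_lipschitz[of "x + a *\<^sub>R v" x] assms by (simp add: mult.assoc)
  then have "(norm (grad f (x + a *\<^sub>R v) - grad f x))\<^sup>2 \<le> L\<^sup>2 * a\<^sup>2 * (norm v)\<^sup>2"
    unfolding power_mult_distrib[symmetric] by (rule power_mono) simp
  moreover have "(norm (grad f (x + a *\<^sub>R v)))\<^sup>2
      \<le> 2 * (norm (grad f x))\<^sup>2 + 2 * (norm (grad f (x + a *\<^sub>R v) - grad f x))\<^sup>2"
    using square_norm_add_le[of "grad f x" "grad f (x + a *\<^sub>R v) - grad f x"] by simp
  ultimately show ?thesis
    by linarith
qed

lemma Bq_ST_le:
  assumes "0 \<le> a"
  shows "Bq_ST f \<mu> L s (x, v) a \<le> qv a * (norm v)\<^sup>2 + qg * (norm (grad f x))\<^sup>2"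
proof -
  define g where "g = grad f (x + a *\<^sub>R v)"
  define V Y G where "V = (norm v)\<^sup>2" and "Y = (norm (grad f x))\<^sup>2" and "G = (norm g)\<^sup>2"
  have "(norm ((2 * r) *\<^sub>R v + m *\<^sub>R g))\<^sup>2 \<le> 8 * \<mu> * V + 2 * m\<^sup>2 * G"
    using square_norm_add_le[of "(2 * r) *\<^sub>R v" "m *\<^sub>R g"] mu_pos
    by (simp add: power_mult_distrib V_def G_def)
  from mult_left_mono[OF this, of "r / 16"]
  have "Bq_ST f \<mu> L s (x, v) a \<le> r / 16 * (8 * \<mu> * V + 2 * m\<^sup>2 * G) + r * m / 4 * (L / 2 * V + m / 4 * G)"
    unfolding Bq_ST.simps Let_def g_def[symmetric] V_def[symmetric] G_def[symmetric]
    using r_pos by simp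
  \<comment> \<open>The two contributions to \<open>G\<close> add up to 2/16 + 1/16 = 3/16; the
    doubling in the next step yields the 3/8 of \<open>qg\<close>.\<close>
  also have "\<dots> = r / 16 * (8 * \<mu> * V) + r * m / 4 * (L / 2 * V) + 3 / 16 * r * m\<^sup>2 * G"
    by (simp add: algebra_simps power2_eq_square)
  also have "\<dots> \<le> r / 16 * (8 * \<mu> * V) + r * m / 4 * (L / 2 * V)
      + 3 / 16 * r * m\<^sup>2 * (2 * Y + 2 * (L\<^sup>2 * a\<^sup>2 * V))"
    using displaced_grad_norm_le[OF assms, of x v] r_pos
    by (intro add_left_mono mult_left_mono) (auto simp: V_def Y_def G_def g_def)
  also have "\<dots> = qv a * V + qg * Y"
    by (simp add: qv_def qg_def field_simps power2_eq_square)
  finally show ?thesis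
    unfolding V_def Y_def .
qed

lemma A_Bl_ST_le:
  assumes "0 \<le> a"
  shows "A_ST f \<mu> L s (x, v) a + Bl_ST f \<mu> L s (x, v) a
    \<le> 2 * qv a * nu1 \<mu> L s a * (norm v)\<^sup>2 + 2 * qg * nu2 \<mu> s a * (norm (grad f x))\<^sup>2"
proof -
  define g where "g = grad f (x + a *\<^sub>R v)"
  define V Y G where "V = (norm v)\<^sup>2" and "Y = (norm (grad f x))\<^sup>2" and "G = (norm g)\<^sup>2"
  have "0 \<le> V" "0 \<le> G"
    by (auto simp: V_def G_def)
  have "0 \<le> \<mu> * a * V"
    using mu_pos assms \<open>0 \<le> V\<close> by simp
  also have "\<dots> \<le> (g - grad f x) \<bullet> v"
    using grad_line_ge[OF assms] unfolding g_def V_def .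
  finally have "r / 4 * (m * ((grad f x - g) \<bullet> v)) \<le> 0"
    using r_pos m_ge_1 by (auto simp: inner_diff_left intro!: mult_nonneg_nonpos)
  \<comment> \<open>Nonnegative quantities: the first is added because \<open>nu1\<close> contains
    it, the other two occur with a minus sign and are dropped.\<close>
  moreover have "0 \<le> r * m * a * L / 4 * V" "0 \<le> r / 4 * (r * V)" "0 \<le> r / 4 * (m * (r / L * G))"
    using r_pos m_ge_1 assms L_pos \<open>0 \<le> V\<close> \<open>0 \<le> G\<close> by auto
  moreover have "r / 4 * (m * (r * (a * (v \<bullet> g)))) = a * \<mu> * m / 4 * (g \<bullet> v)"
    using mu_pos by (simp add: inner_commute field_simps)
  moreover have "A_ST f \<mu> L s (x, v) a + Bl_ST f \<mu> L s (x, v) a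
      = 2 * \<mu> * V + m * L * V + m\<^sup>2 * G + 2 * r * m * (g \<bullet> v) + r / 4 * (m * ((grad f x - g) \<bullet> v))
        - r / 4 * (r * V) - r / 4 * (m * (r / L * G)) + r / 4 * (m * (r * (a * (v \<bullet> g))))"
    unfolding A_ST.simps Bl_ST.simps Let_def g_def[symmetric] V_def[symmetric] G_def[symmetric] inner_scaleR_left
    by (simp only: distrib_left right_diff_distrib) (simp add: power2_eq_square)
  ultimately have "A_ST f \<mu> L s (x, v) a + Bl_ST f \<mu> L s (x, v) a
      \<le> 2 * \<mu> * V + m * L * V + m\<^sup>2 * G + r * m * a * L / 4 * V + (2 * r * m + a * \<mu> * m / 4) * (g \<bullet> v)"
    unfolding distrib_right by linarith
  also have "\<dots> \<le> 2 * \<mu> * V + m * L * V + m\<^sup>2 * G + r * m * a * L / 4 * V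
      + (2 * r * m + a * \<mu> * m / 4) * ((G + V) / 2)"
    using inner_le_half_squares[of g v] r_pos m_ge_1 assms mu_pos
    by (intro add_left_mono mult_left_mono) (auto simp: V_def G_def)
  also have "\<dots> = 2 * \<mu> * V + m * L * V + r * m * a * L / 4 * V + (r * m + a * \<mu> * m / 8) * V
      + (m\<^sup>2 + r * m + a * \<mu> * m / 8) * G"
    by (simp add: field_simps)
  also have "\<dots> \<le> 2 * \<mu> * V + m * L * V + r * m * a * L / 4 * V + (r * m + a * \<mu> * m / 8) * V
      + (m\<^sup>2 + r * m + a * \<mu> * m / 8) * (2 * Y + 2 * (L\<^sup>2 * a\<^sup>2 * V))"
    using displaced_grad_norm_le[OF assms, of x v] r_pos m_ge_1 assms mu_pos
    by (intro add_left_mono mult_left_mono) (auto simp: V_def Y_def G_def g_def)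
  also have "\<dots> = 2 * qv a * nu1 \<mu> L s a * V + 2 * qg * nu2 \<mu> s a * Y"
    unfolding qv_nu1 qg_nu2 by (simp add: algebra_simps power2_eq_square power3_eq_cube)
  finally show ?thesis
    unfolding V_def Y_def .
qed

lemma b_d_le:
  assumes "0 \<le> a" and "0 \<le> t"
  shows "b_d h f \<mu> L s (x, v) t a
    \<le> qv a * (t\<^sup>2 + 2 * nu1 \<mu> L s a * t - eta1 \<mu> L s a) * (norm v)\<^sup>2
      + qg * (t\<^sup>2 + 2 * nu2 \<mu> s a * t - eta2 \<mu> L s a) * (norm (grad f x))\<^sup>2"
proof -
  have "b_d h f \<mu> L s (x, v) t a \<le> b_d ST f \<mu> L s (x, v) t a"
    using assms by (intro b_d_le_b_ST)
  also have "\<dots> \<le> (qv a * (norm v)\<^sup>2 + qg * (norm (grad f x))\<^sup>2) * t\<^sup>2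
     + (2 * qv a * nu1 \<mu> L s a * (norm v)\<^sup>2 + 2 * qg * nu2 \<mu> s a * (norm (grad f x))\<^sup>2) * t
     + (- (qv a * eta1 \<mu> L s a) * (norm v)\<^sup>2 - qg * eta2 \<mu> L s a * (norm (grad f x))\<^sup>2)"
    unfolding b_d.simps C_ST_def qv_eta1 qg_eta2 using assms
    by (intro add_mono mult_right_mono Bq_ST_le A_Bl_ST_le C_ET_le) auto
  finally show ?thesis
    by (simp add: algebra_simps)
qed

text \<open>By \<open>qv_eta1\<close> and \<open>qg_eta2\<close>, both \<eta> have the sign of
  expressions that decrease in \<open>a \<ge> 0\<close> and are positive below their roots. The
  factor \<alpha> < 1 keeps \<open>a\<close> strictly below both roots.\<close>

lemma a2_star_bounds:
  assumes "0 < \<alpha>" and "\<alpha> < 1"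
  shows "0 < a2_star \<mu> L s \<alpha>"
    and "\<And>a. 0 \<le> a \<Longrightarrow> a \<le> a2_star \<mu> L s \<alpha> \<Longrightarrow> 0 < eta1 \<mu> L s a \<and> 0 < eta2 \<mu> L s a"
proof -
  define b1 b2 b3 b4 b5 where "b1 = beta1 \<mu> L s" and "b2 = beta2 \<mu> s" and "b3 = beta3 \<mu>"
    and "b4 = beta4 \<mu> L s" and "b5 = beta5 \<mu> L s"
  note b_def = b1_def b2_def b3_def b4_def b5_def
  have b: "0 < b1" "0 < b2" "0 < b3" "0 < b4" "0 < b5"
    unfolding b_def by (rule beta1_pos beta2_pos beta3_pos beta4_pos beta5_pos)+
  define S where "S = sqrt (b1\<^sup>2 + 4 * b5 * b3)"
  define \<rho> where "\<rho> = (- b1 + S) / (2 * b5)"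
  have "sqrt (b1\<^sup>2) < S"
    unfolding S_def using b by (intro real_sqrt_less_mono) simp
  then have "b1 < S"
    using b by simp
  then have "0 < \<rho>"
    using b by (simp add: \<rho>_def)
  have S: "S = 2 * b5 * \<rho> + b1"
    using b by (simp add: \<rho>_def)
  have "S\<^sup>2 = b1\<^sup>2 + 4 * b5 * b3"
    unfolding S_def using b by (intro real_sqrt_pow2) simp
  then have "4 * b5 * (b5 * \<rho>\<^sup>2 + b1 * \<rho>) = 4 * b5 * b3"
    unfolding S by (simp add: algebra_simps power2_eq_square)
  then have root: "b5 * \<rho>\<^sup>2 + b1 * \<rho> = b3"
    using b by simp
  have a2: "a2_star \<mu> L s \<alpha> = \<alpha> * min \<rho> (b4 / b2)"
    by (simp add: a2_star_def \<rho>_def S_def b_def)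
  show "0 < a2_star \<mu> L s \<alpha>"
    unfolding a2 using assms b \<open>0 < \<rho>\<close> by simp
  fix a assume a: "0 \<le> a" "a \<le> a2_star \<mu> L s \<alpha>"
  have "\<alpha> * min \<rho> (b4 / b2) < 1 * min \<rho> (b4 / b2)"
    using assms b \<open>0 < \<rho>\<close> by (intro mult_strict_right_mono) auto
  with a have lt: "a < \<rho>" "a < b4 / b2"
    unfolding a2 by auto
  have "b5 * a\<^sup>2 + b1 * a < b5 * \<rho>\<^sup>2 + b1 * \<rho>"
    using lt a b by (intro add_strict_mono mult_strict_left_mono power_strict_mono) auto
  then have "0 < qv a * eta1 \<mu> L s a"
    unfolding qv_eta1 root b_def[symmetric] by (simp add: algebra_simps)
  moreover have "0 < qg * eta2 \<mu> L s a"
    unfolding qg_eta2 b_def[symmetric] using lt b by (simp add: field_simps)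
  ultimately show "0 < eta1 \<mu> L s a \<and> 0 < eta2 \<mu> L s a"
    using qv_pos[of a] qg_pos by (simp add: zero_less_mult_iff)
qed

text \<open>\<open>MIET\<close> is the positive root of t^2 + 2 \<nu> t - \<eta>, which dominates
  both brackets of \<open>b_d_le\<close> for t \<ge> 0. Strictness comes from the gradient term,
  since \<open>v\<close> may vanish.\<close>

lemma b_d_neg_before_MIET:
  assumes "0 \<le> a" and "0 < eta1 \<mu> L s a" and "0 < eta2 \<mu> L s a"
    and "grad f x \<noteq> 0" and "0 \<le> t" and "t < MIET \<mu> L s a"
  shows "b_d h f \<mu> L s (x, v) t a < 0"
proof -
  define \<eta> \<nu> where "\<eta> = min (eta1 \<mu> L s a) (eta2 \<mu> L s a)" and "\<nu> = max (nu1 \<mu> L s a) (nu2 \<mu> s a)"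
  have "0 < \<eta>" "0 \<le> \<nu>"
    using assms nu2_nonneg[of a] by (auto simp: \<eta>_def \<nu>_def)
  have "t + \<nu> < sqrt (\<nu>\<^sup>2 + \<eta>)"
    using assms(6) by (simp add: MIET_def Let_def \<eta>_def \<nu>_def)
  then have "(t + \<nu>)\<^sup>2 < (sqrt (\<nu>\<^sup>2 + \<eta>))\<^sup>2"
    using assms \<open>0 \<le> \<nu>\<close> by (intro power_strict_mono) auto
  then have "t\<^sup>2 + 2 * \<nu> * t - \<eta> < 0"
    using \<open>0 < \<eta>\<close> by (simp add: power2_eq_square algebra_simps)
  moreover have "nu1 \<mu> L s a * t \<le> \<nu> * t" "nu2 \<mu> s a * t \<le> \<nu> * t"
    using assms by (auto simp: \<nu>_def intro!: mult_right_mono)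
  moreover have "\<eta> \<le> eta1 \<mu> L s a" "\<eta> \<le> eta2 \<mu> L s a"
    by (auto simp: \<eta>_def)
  ultimately have "t\<^sup>2 + 2 * nu1 \<mu> L s a * t - eta1 \<mu> L s a < 0" "t\<^sup>2 + 2 * nu2 \<mu> s a * t - eta2 \<mu> L s a < 0"
    by linarith+
  then have "qv a * (t\<^sup>2 + 2 * nu1 \<mu> L s a * t - eta1 \<mu> L s a) * (norm v)\<^sup>2 \<le> 0"
    and "qg * (t\<^sup>2 + 2 * nu2 \<mu> s a * t - eta2 \<mu> L s a) * (norm (grad f x))\<^sup>2 < 0"
    using qv_pos[of a] qg_pos assms by (auto simp: mult_le_0_iff mult_less_0_iff zero_less_mult_iff)
  with b_d_le[OF assms(1,5), of h x v] show ?thesis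
    by linarith
qed

lemma MIET_pos:
  assumes "0 \<le> a" and "0 < eta1 \<mu> L s a" and "0 < eta2 \<mu> L s a"
  shows "0 < MIET \<mu> L s a"
proof -
  define \<eta> \<nu> where "\<eta> = min (eta1 \<mu> L s a) (eta2 \<mu> L s a)" and "\<nu> = max (nu1 \<mu> L s a) (nu2 \<mu> s a)"
  have "0 < \<eta>" "0 \<le> \<nu>"
    using assms nu2_nonneg[of a] by (auto simp: \<eta>_def \<nu>_def)
  then have "sqrt (\<nu>\<^sup>2) < sqrt (\<nu>\<^sup>2 + \<eta>)"
    by (intro real_sqrt_less_mono) simp
  then show ?thesis
    using \<open>0 \<le> \<nu>\<close> by (simp add: MIET_def Let_def \<eta>_def \<nu>_def)
qed


section \<open>The stepsize\<close>

lemma continuous_on_line: "continuous_on S (\<lambda>t. f (x + t *\<^sub>R v))"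
  by (rule DERIV_continuous_on) (rule has_real_derivative_line)

lemma continuous_on_grad_line: "continuous_on S (\<lambda>t. grad f (x + t *\<^sub>R v))"
  using lipschitz_on_continuous_on[OF lipschitz]
  by (rule continuous_on_compose2) (auto intro!: continuous_intros)

lemma continuous_on_b_d: "continuous_on S (\<lambda>t. b_d h f \<mu> L s p t a)"
  using L_pos by (cases h; cases p)
    (auto simp: A_ET.simps B_ET.simps C_ET.simps A_ST.simps Bl_ST.simps Bq_ST.simps Let_def
      intro!: continuous_intros continuous_on_line continuous_on_grad_line)

text \<open>Convexity bounds the trigger below by a quadratic in \<open>t\<close>. Its leading
  coefficient is positive: either \<open>v\<close> is nonzero, or \<open>g\<close> equals the
  nonzero \<open>grad f x\<close>. Hence the trigger cannot stay negative.\<close>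

lemma b_d_eventually_ge:
  assumes "grad f x \<noteq> 0"
  obtains T where "0 < T" and "\<And>t. T \<le> t \<Longrightarrow> K \<le> b_d h f \<mu> L s (x, v) t a"
proof -
  define g where "g = grad f (x + a *\<^sub>R v)"
  define V G where "V = (norm v)\<^sup>2" and "G = (norm g)\<^sup>2"
  define c where "c = r / 16 * (norm ((2 * r) *\<^sub>R v + m *\<^sub>R g))\<^sup>2 + r * m / 4 * (\<mu> / 2 * V + m / 4 * G)"
  define e where "e = 2 * \<mu> * V + m * (2 * r * (g \<bullet> v) + m * G) - \<mu> / 4 * V
    + r * m / 4 * (grad f x \<bullet> v - v \<bullet> g - r / L * G + r * ((a *\<^sub>R v) \<bullet> g))"
  have "0 < c"
  proof -
    have "0 < \<mu> / 2 * V + m / 4 * G"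
    proof (cases "v = 0")
      case True
      then have "0 < G"
        using assms by (simp add: G_def g_def)
      then show ?thesis
        using m_ge_1 mu_pos by (auto simp: V_def intro!: add_nonneg_pos)
    next
      case False
      then show ?thesis
        using m_ge_1 mu_pos by (auto simp: V_def G_def intro!: add_pos_nonneg)
    qed
    then show ?thesis
      using r_pos m_ge_1 by (auto simp: c_def intro!: add_nonneg_pos mult_pos_pos)
  qed
  have lower: "c * t\<^sup>2 + e * t + C_ET f \<mu> L s (x, v) a \<le> b_d h f \<mu> L s (x, v) t a" if "0 \<le> t" for t
  proof -
    have "0 \<le> \<mu> * t * (norm v)\<^sup>2"
      using mu_pos that by simp
    also have "\<dots> \<le> (grad f (x + t *\<^sub>R v) - grad f x) \<bullet> v"
      by (rule grad_line_ge[OF that])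
    finally have A: "0 \<le> m * ((grad f (x + t *\<^sub>R v) - grad f x) \<bullet> v)"
      using m_ge_1 by simp
    have "t * (grad f x \<bullet> v) + \<mu> / 2 * t\<^sup>2 * V \<le> f (x + t *\<^sub>R v) - f x"
      using convex_lower[of x "x + t *\<^sub>R v"] by (simp add: power_mult_distrib V_def)
    then have B: "r * m / 4 * (t * (grad f x \<bullet> v) + \<mu> / 2 * t\<^sup>2 * V) \<le> r * m / 4 * (f (x + t *\<^sub>R v) - f x)"
      using r_pos m_ge_1 by (intro mult_left_mono) auto
    have "A_ET f \<mu> s (x, v) t a + B_ET f \<mu> L s (x, v) t a = c * t\<^sup>2 + e * t
      + m * ((grad f (x + t *\<^sub>R v) - grad f x) \<bullet> v)
      + (r * m / 4 * (f (x + t *\<^sub>R v) - f x) - r * m / 4 * (t * (grad f x \<bullet> v) + \<mu> / 2 * t\<^sup>2 * V))"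
      unfolding A_ET.simps B_ET.simps Let_def g_def[symmetric] V_def[symmetric] G_def[symmetric] c_def e_def
      by (simp only: distrib_left distrib_right left_diff_distrib right_diff_distrib)
        (simp add: power2_eq_square mult_ac)
    with A B have "c * t\<^sup>2 + e * t + C_ET f \<mu> L s (x, v) a \<le> b_d ET f \<mu> L s (x, v) t a"
      unfolding b_d.simps by linarith
    from this b_ET_le_b_d[OF that] show ?thesis
      by (rule order_trans)
  qed
  obtain T where "0 < T" "\<And>t. T \<le> t \<Longrightarrow> K \<le> c * t\<^sup>2 + e * t + C_ET f \<mu> L s (x, v) a"
    using quadratic_eventually_ge[OF \<open>0 < c\<close>] by metis
  moreover from this(1,2) have "K \<le> b_d h f \<mu> L s (x, v) t a" if "T \<le> t" for t
    using lower[of t] that by (meson less_imp_le order_trans)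
  ultimately show ?thesis
    using that by blast
qed

text \<open>At t = 0 each \<open>b_d\<close> reduces to \<open>C_trig\<close>, and continuity
  extends the sign.\<close>

lemma b_d_neg_near_0:
  assumes "C_trig h f \<mu> L s p a < 0"
  obtains \<delta> where "0 < \<delta>" and "\<And>t. 0 < t \<Longrightarrow> t < \<delta> \<Longrightarrow> b_d h f \<mu> L s p t a < 0"
proof -
  have "b_d h f \<mu> L s p 0 a < 0"
    using assms by (cases h; cases p) (auto simp: A_ET.simps B_ET.simps C_ST_def Let_def)
  moreover have "isCont (\<lambda>t. b_d h f \<mu> L s p t a) 0"
    using continuous_on_b_d[of UNIV] by (simp add: continuous_on_eq_continuous_at)
  ultimately have "\<forall>\<^sub>F t in at 0. b_d h f \<mu> L s p t a < 0"
    using order_tendstoD(2) unfolding isCont_def by blast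
  then show ?thesis
    using that by (auto simp: eventually_at dist_real_def)
qed

section \<open>The integrated, performance-based trigger\<close>

lemma continuous_on_b_p_integrand: "continuous_on S (\<lambda>t. exp (r / 4 * t) * b_d h f \<mu> L s p t a)"
  by (intro continuous_intros continuous_on_b_d)

lemma integrable_b_p_integrand: "(\<lambda>t. exp (r / 4 * t) * b_d h f \<mu> L s p t a) integrable_on {u..w}"
  by (intro integrable_continuous_real continuous_on_b_p_integrand)

lemma b_p_neg:
  assumes "0 < t" and "\<And>u. 0 < u \<Longrightarrow> u < t \<Longrightarrow> b_d h f \<mu> L s p u a < 0"
  shows "b_p h f \<mu> L s p t a < 0"
proof -
  have "integral {0..t} (\<lambda>u. exp (r / 4 * u) * b_d h f \<mu> L s p u a) < integral {0..t} (\<lambda>_. 0)"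
    using assms by (intro integral_less_real continuous_on_b_p_integrand continuous_on_const)
      (auto simp: mult_less_0_iff)
  then show ?thesis
    by (simp add: b_p_def)
qed

lemma continuous_on_b_p: "continuous_on {0..} (\<lambda>t. b_p h f \<mu> L s p t a)"
proof (clarsimp simp: continuous_on_eq_continuous_within)
  fix t :: real assume "0 \<le> t"
  have "continuous_on {0..t + 1} (\<lambda>t. b_p h f \<mu> L s p t a)"
    unfolding b_p_def by (intro indefinite_integral_continuous_1 integrable_b_p_integrand)
  then have "continuous (at t within {0..t + 1}) (\<lambda>t. b_p h f \<mu> L s p t a)"
    using \<open>0 \<le> t\<close> by (simp add: continuous_on_eq_continuous_within)
  \<comment> \<open>Continuity is local, so the compact interval on which the integral is known to
    be continuous suffices at each point of the half-line.\<close>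
  moreover have "at t within {0..t + 1} = at t within {0..}"
    by (rule at_within_nhd[of _ "{..<t + 1}"]) auto
  ultimately show "continuous (at t within {0..}) (\<lambda>t. b_p h f \<mu> L s p t a)"
    by (simp add: continuous_within)
qed

lemma b_p_eventually_nonneg:
  assumes "grad f x \<noteq> 0"
  obtains T where "0 < T" and "0 \<le> b_p h f \<mu> L s (x, v) T a"
proof -
  obtain T where T: "0 < T" "\<And>t. T \<le> t \<Longrightarrow> 1 \<le> b_d h f \<mu> L s (x, v) t a"
    using b_d_eventually_ge[OF assms] by metis
  \<comment> \<open>Past \<open>T\<close> the integrand is at least 1, so a further interval of
    length \<open>B\<close> makes up for a negative value at \<open>T\<close>.\<close>
  define B where "B = \<bar>b_p h f \<mu> L s (x, v) T a\<bar>"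
  let ?F = "\<lambda>t. exp (r / 4 * t) * b_d h f \<mu> L s (x, v) t a"
  have "B = integral {T..T + B} (\<lambda>_. 1)"
    by (simp add: B_def)
  also have "\<dots> \<le> integral {T..T + B} ?F"
  proof (rule integral_le[OF _ integrable_b_p_integrand])
    fix t assume "t \<in> {T..T + B}"
    then have "1 * 1 \<le> ?F t"
      using T r_pos by (intro mult_mono) auto
    then show "1 \<le> ?F t"
      by simp
  qed (rule integrable_const_ivl)
  also have "integral {0..T} ?F + integral {T..T + B} ?F = integral {0..T + B} ?F"
    using T by (intro Henstock_Kurzweil_Integration.integral_combine integrable_b_p_integrand) (auto simp: B_def)
  then have "integral {T..T + B} ?F = b_p h f \<mu> L s (x, v) (T + B) a - b_p h f \<mu> L s (x, v) T a"
    by (simp add: b_p_def)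
  finally show ?thesis
    using T by (intro that[of "T + B"]) (auto simp: B_def)
qed

text \<open>All four rules at once: the trigger is negative right after 0 and nonnegative somewhere,
  so the stepsize is a genuine first zero. There \<open>b_p\<close> vanishes under
  \<open>Perf\<close>; under \<open>Deriv\<close> it is the integral of a function negative on the
  open interval before the step.\<close>

lemma stepsize_properties:
  fixes x v :: 'a and a :: real and d :: crit and h :: trig
  assumes "grad f x \<noteq> 0" and "C_trig h f \<mu> L s (x, v) a < 0"
  defines "\<Delta> \<equiv> stepsize d h f \<mu> L s (x, v) a"
  shows "0 < \<Delta>" and "b_p h f \<mu> L s (x, v) \<Delta> a \<le> 0"
    and "\<And>M. (\<And>t. 0 < t \<Longrightarrow> t < M \<Longrightarrow> b_d h f \<mu> L s (x, v) t a < 0) \<Longrightarrow> M \<le> \<Delta>"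
proof -
  \<comment> \<open>Negativity of \<open>b_d\<close> on an initial interval passes to its weighted
    integral, so the same argument bounds the stepsize below under both criteria.\<close>
  have neg: "b_fun d h f \<mu> L s (x, v) t a < 0"
    if "0 < t" "t < M" "\<And>t. 0 < t \<Longrightarrow> t < M \<Longrightarrow> b_d h f \<mu> L s (x, v) t a < 0" for t M
  proof (cases d)
    case Deriv
    show ?thesis
      unfolding Deriv b_fun.simps using that by blast
  next
    case Perf
    show ?thesis
      unfolding Perf b_fun.simps using that by (intro b_p_neg) auto
  qed
  obtain \<delta> where \<delta>: "0 < \<delta>" "\<And>t. 0 < t \<Longrightarrow> t < \<delta> \<Longrightarrow> b_d h f \<mu> L s (x, v) t a < 0"
    using b_d_neg_near_0[OF assms(2)] by blast
  obtain T where T: "0 < T" "0 \<le> b_fun d h f \<mu> L s (x, v) T a"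
  proof (cases d)
    case Deriv
    show ?thesis
      by (rule b_d_eventually_ge[OF assms(1), of 0 h v a]) (use that in \<open>simp add: Deriv\<close>)
  next
    case Perf
    show ?thesis
      by (rule b_p_eventually_nonneg[OF assms(1), of h v a]) (use that in \<open>simp add: Perf\<close>)
  qed
  have cont: "continuous_on {0..} (\<lambda>t. b_fun d h f \<mu> L s (x, v) t a)"
    by (cases d) (simp_all only: b_fun.simps continuous_on_b_d continuous_on_b_p)
  note first_zero = LEAST_positive_zero[OF cont \<delta>(1) neg[OF _ _ \<delta>(2)] T,
      folded stepsize_def \<Delta>_def]
  show pos: "0 < \<Delta>"
    by (rule first_zero)
  have zero: "b_fun d h f \<mu> L s (x, v) \<Delta> a = 0"
    by (rule first_zero)
  show "b_p h f \<mu> L s (x, v) \<Delta> a \<le> 0"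
  proof (cases d)
    case Deriv
    have "b_p h f \<mu> L s (x, v) \<Delta> a < 0"
      using first_zero(3) unfolding Deriv b_fun.simps by (rule b_p_neg[OF pos])
    then show ?thesis
      by simp
  next
    case Perf
    show ?thesis
      using zero unfolding Perf b_fun.simps by simp
  qed
  show "M \<le> \<Delta>" if "\<And>t. 0 < t \<Longrightarrow> t < M \<Longrightarrow> b_d h f \<mu> L s (x, v) t a < 0" for M
  proof (rule ccontr)
    assume "\<not> M \<le> \<Delta>"
    then have "b_fun d h f \<mu> L s (x, v) \<Delta> a < 0"
      using pos that by (intro neg) auto
    with zero show False
      by simp
  qed
qed

text \<open>With the integrating factor \<open>exp (r / 4 * t)\<close>, the increase of the weighted
  \<open>lyap\<close> over the step is at most \<open>b_p\<close>, hence nonpositive.\<close>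

lemma lyap_decay:
  assumes "0 \<le> a" and "0 \<le> \<Delta>" and "b_p h f \<mu> L s p \<Delta> a \<le> 0"
  shows "lyap (p + \<Delta> *\<^sub>R X_hb f \<mu> s a p) \<le> exp (- (r / 4) * \<Delta>) * lyap p"
proof -
  let ?V = "\<lambda>t. lyap (p + t *\<^sub>R X_hb f \<mu> s a p)"
  obtain x v where p: "p = (x, v)"
    by (cases p)
  have "\<exists>D. (?V has_real_derivative D) (at t) \<and> D + r / 4 * ?V t \<le> b_d h f \<mu> L s p t a" if t: "0 \<le> t" for t
  proof -
    obtain D where "(?V has_real_derivative D) (at t)" "D + r / 4 * ?V t \<le> b_d ET f \<mu> L s p t a"
      unfolding p by (rule lyap_rate_le_b_ET[OF assms(1) t])
    then show ?thesis
      using order_trans[OF _ b_ET_le_b_d[OF t]] by blast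
  qed
  then obtain D where D: "\<And>t. 0 \<le> t \<Longrightarrow> (?V has_real_derivative D t) (at t)"
      "\<And>t. 0 \<le> t \<Longrightarrow> D t + r / 4 * ?V t \<le> b_d h f \<mu> L s p t a"
    by metis
  let ?W = "\<lambda>t. exp (r / 4 * t) * (D t + r / 4 * ?V t)"
  have "((\<lambda>t. exp (r / 4 * t) * ?V t) has_real_derivative ?W t) (at t within S)" if "0 \<le> t" for t S
  proof -
    have "((\<lambda>t. exp (r / 4 * t)) has_real_derivative r / 4 * exp (r / 4 * t)) (at t)"
      by (auto intro!: derivative_eq_intros)
    from DERIV_mult[OF this D(1)[OF that]] show ?thesis
      by (rule has_field_derivative_at_within[OF DERIV_cong]) (simp add: algebra_simps)
  qed
  then have "(?W has_integral exp (r / 4 * \<Delta>) * ?V \<Delta> - exp (r / 4 * 0) * ?V 0) {0..\<Delta>}"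
    using assms by (intro fundamental_theorem_of_calculus)
      (auto simp flip: has_real_derivative_iff_has_vector_derivative)
  moreover have "((\<lambda>t. exp (r / 4 * t) * b_d h f \<mu> L s p t a) has_integral b_p h f \<mu> L s p \<Delta> a) {0..\<Delta>}"
    unfolding b_p_def by (intro integrable_integral integrable_b_p_integrand)
  ultimately have "exp (r / 4 * \<Delta>) * ?V \<Delta> - exp (r / 4 * 0) * ?V 0 \<le> b_p h f \<mu> L s p \<Delta> a"
    by (rule has_integral_le) (intro mult_left_mono D(2); simp)
  with assms have "exp (r / 4 * \<Delta>) * ?V \<Delta> \<le> lyap p"
    by (simp add: zero_prod_def[symmetric])
  then show ?thesis
    by (simp add: exp_minus field_simps)
qed


lemma C_trig_neg:
  assumes "0 \<le> a" and "0 < eta1 \<mu> L s a" and "0 < eta2 \<mu> L s a" and "grad f x \<noteq> 0"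
  shows "C_trig h f \<mu> L s (x, v) a < 0"
proof -
  have "0 \<le> qv a * eta1 \<mu> L s a * (norm v)\<^sup>2" "0 < qg * eta2 \<mu> L s a * (norm (grad f x))\<^sup>2"
    using assms qv_pos[of a] qg_pos by auto
  then have "C_ET f \<mu> L s (x, v) a < 0"
    using C_ET_le[OF assms(1), of x v] unfolding qv_eta1[symmetric] qg_eta2[symmetric] mult_minus_left
    by linarith
  then show ?thesis
    by (cases h) (auto simp: C_ST_def)
qed

section \<open>The adaptive algorithm\<close>

context
  fixes d :: crit and h :: trig and \<alpha> \<tau> ri rd :: real
  assumes alpha: "0 < \<alpha>" "\<alpha> < 1"
    and tau: "\<tau> \<le> (INF a\<in>{0..a2_star \<mu> L s \<alpha>}. MIET \<mu> L s a)"
    and ri: "1 < ri" and rd: "0 < rd" "rd < 1"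
begin

text \<open>The stepsize is at least \<open>MIET\<close> at this \<open>a\<close>, which is at least
  the infimum, which is at least \<tau>.\<close>

lemma not_must_decrease:
  assumes "0 \<le> a" and "a \<le> a2_star \<mu> L s \<alpha>" and "grad f x \<noteq> 0"
  shows "\<not> must_decrease d h f \<mu> L s \<tau> (x, v) a"
proof -
  note eta_pos = a2_star_bounds(2)[OF alpha]
  \<comment> \<open>The infimum is a lower bound only for a set bounded below;
    \<open>MIET_pos\<close> supplies the bound 0.\<close>
  have "bdd_below (MIET \<mu> L s ` {0..a2_star \<mu> L s \<alpha>})"
    using MIET_pos eta_pos by (intro bdd_belowI2[of _ 0]) (auto intro: less_imp_le)
  then have "\<tau> \<le> MIET \<mu> L s a"
    using tau assms by (intro order_trans[OF tau] cINF_lower) auto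
  moreover have C: "C_trig h f \<mu> L s (x, v) a < 0"
    using eta_pos assms by (intro C_trig_neg) auto
  moreover have "MIET \<mu> L s a \<le> stepsize d h f \<mu> L s (x, v) a"
    using eta_pos assms by (intro stepsize_properties(3) b_d_neg_before_MIET C) auto
  ultimately show ?thesis
    by (auto simp: must_decrease_def)
qed

text \<open>The tested values \<open>a * rd ^ n\<close> tend to 0 and so drop below the positive
  \<open>a2_star\<close>, where the loop condition fails.\<close>

lemma search_a_terminates:
  assumes "0 \<le> a" and "grad f x \<noteq> 0"
  shows "search_a d h f \<mu> L s \<tau> rd (x, v) a \<noteq> None"
proof -
  have "(\<lambda>n. a * rd ^ n) \<longlonglongrightarrow> 0"
    using rd by (intro tendsto_mult_right_zero LIMSEQ_realpow_zero) auto
  then have "\<forall>\<^sub>F n in sequentially. a * rd ^ n < a2_star \<mu> L s \<alpha>"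
    using a2_star_bounds(1)[OF alpha] by (rule order_tendstoD)
  then obtain n where "a * rd ^ n < a2_star \<mu> L s \<alpha>"
    by (auto simp: eventually_sequentially)
  then have "\<not> must_decrease d h f \<mu> L s \<tau> (x, v) (a * rd ^ n)"
    using assms rd by (intro not_must_decrease) auto
  moreover have "((\<lambda>a. a * rd) ^^ n) a = a * rd ^ n"
    by (induction n) auto
  ultimately show ?thesis
    unfolding search_a_def while_option_def by (auto simp: exI[of _ n])
qed

lemma search_a_Some:
  assumes "search_a d h f \<mu> L s \<tau> rd p a = Some a'" and "0 \<le> a"
  shows "0 \<le> a'" and "C_trig h f \<mu> L s p a' < 0" and "\<tau> \<le> stepsize d h f \<mu> L s p a'"
proof -
  show "0 \<le> a'"
    using while_option_rule[of "\<lambda>a. 0 \<le> a", OF _ assms(1)[unfolded search_a_def]] assms(2) rd by simp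
  have "\<not> must_decrease d h f \<mu> L s \<tau> p a'"
    using assms(1) unfolding search_a_def by (rule while_option_stop)
  then show "C_trig h f \<mu> L s p a' < 0" "\<tau> \<le> stepsize d h f \<mu> L s p a'"
    by (auto simp: must_decrease_def)
qed

section \<open>The run of the algorithm from a fixed start\<close>

context
  fixes p0 :: "'a \<times> 'a" and a0 :: real
  assumes a0: "0 \<le> a0"
begin

abbreviation "state \<equiv> adg_state d h f \<mu> L s \<tau> ri rd p0 a0"
abbreviation "\<Delta> \<equiv> adg_step d h f \<mu> L s \<tau> ri rd p0 a0"

lemma adg_iteration:
  assumes "0 \<le> snd (state k)" and "grad f (fst (fst (state k))) \<noteq> 0"
  shows "adg_search d h f \<mu> L s \<tau> ri rd p0 a0 k \<noteq> None" and "\<tau> \<le> \<Delta> k"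
    and "0 \<le> snd (state (Suc k))"
    and "lyap (fst (state (Suc k))) \<le> exp (- (r / 4) * \<Delta> k) * lyap (fst (state k))"
proof -
  obtain x v a where st: "state k = ((x, v), a)"
    by (metis surj_pair)
  have a: "0 \<le> a" and x: "grad f x \<noteq> 0"
    using assms by (auto simp: st)
  obtain a' where a': "search_a d h f \<mu> L s \<tau> rd (x, v) a = Some a'"
    using search_a_terminates[OF a x] by blast
  note props = search_a_Some[OF a' a]
  have \<Delta>: "\<Delta> k = stepsize d h f \<mu> L s (x, v) a'"
    by (simp add: adg_step_def adg_search_def st a')
  have Suc: "state (Suc k) = ((x, v) + \<Delta> k *\<^sub>R X_hb f \<mu> s a' (x, v),
      if must_decrease d h f \<mu> L s \<tau> (x, v) a then a' else a' * ri)"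
    by (simp add: st a' \<Delta> del: X_hb.simps)
  show "adg_search d h f \<mu> L s \<tau> ri rd p0 a0 k \<noteq> None"
    by (simp add: adg_search_def st a')
  show "\<tau> \<le> \<Delta> k"
    unfolding \<Delta> by (rule props)
  show "0 \<le> snd (state (Suc k))"
    unfolding Suc using props(1) ri by auto
  have "0 \<le> \<Delta> k" "b_p h f \<mu> L s (x, v) (\<Delta> k) a' \<le> 0"
    unfolding \<Delta> using stepsize_properties(1,2)[OF x props(2), of d] by auto
  then show "lyap (fst (state (Suc k))) \<le> exp (- (r / 4) * \<Delta> k) * lyap (fst (state k))"
    unfolding Suc st fst_conv by (rule lyap_decay[OF props(1)])
qed

text \<open>The gradients are assumed nonzero only before \<open>k\<close>, so the bound also covers
  the point produced by the last iteration, where the outer test may fail.\<close>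

lemma adg_invariant:
  assumes "\<forall>j<k. grad f (fst (fst (state j))) \<noteq> 0"
  shows "0 \<le> snd (state k)"
    and "lyap (fst (state k)) \<le> lyap p0 * exp (- (r / 4) * (\<Sum>i<k. \<Delta> i))"
proof -
  have "0 \<le> snd (state k) \<and> lyap (fst (state k)) \<le> lyap p0 * exp (- (r / 4) * (\<Sum>i<k. \<Delta> i))"
    using assms
  proof (induction k)
    case 0
    then show ?case
      using a0 by simp
  next
    case (Suc k)
    then have IH: "0 \<le> snd (state k)" "lyap (fst (state k)) \<le> lyap p0 * exp (- (r / 4) * (\<Sum>i<k. \<Delta> i))"
      by auto
    note step = adg_iteration[OF IH(1) Suc.prems[rule_format, OF lessI]]
    note step(4)
    also have "exp (- (r / 4) * \<Delta> k) * lyap (fst (state k))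
        \<le> exp (- (r / 4) * \<Delta> k) * (lyap p0 * exp (- (r / 4) * (\<Sum>i<k. \<Delta> i)))"
      by (intro mult_left_mono IH(2)) simp
    also have "\<dots> = lyap p0 * exp (- (r / 4) * (\<Sum>i<Suc k. \<Delta> i))"
      by (simp add: algebra_simps flip: exp_add)
    finally show ?case
      using step(3) by blast
  qed
  then show "0 \<le> snd (state k)" "lyap (fst (state k)) \<le> lyap p0 * exp (- (r / 4) * (\<Sum>i<k. \<Delta> i))"
    by auto
qed

end

end

end

theorem propositionV1:
  fixes f :: "real ^ 'n \<Rightarrow> real" and xstar :: "real ^ 'n"
    and p0 :: "(real ^ 'n) \<times> (real ^ 'n)"
    and \<mu> L s \<alpha> \<tau> ri rd a0 :: real
    and d :: crit and h :: trig
  assumes "\<mu> > 0" and "L > 0" and "s > 0"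
    and "cont_diff f" and "strongly_convex \<mu> f" and "L-lipschitz_on UNIV (grad f)"
    and "\<forall>y. f xstar \<le> f y"
    and "0 < \<alpha>" and "\<alpha> < 1"
    and "\<tau> \<le> (INF a\<in>{0..a2_star \<mu> L s \<alpha>}. MIET \<mu> L s a)"
    and "ri > 1" and "0 < rd" and "rd < 1" and "a0 \<ge> 0"
  shows "(\<forall>\<epsilon>>0. \<forall>k. performed d h f \<mu> L s \<tau> ri rd p0 a0 \<epsilon> k \<longrightarrow>
            adg_search d h f \<mu> L s \<tau> ri rd p0 a0 k \<noteq> None) \<and>
         (\<forall>\<epsilon>>0. \<forall>k. performed d h f \<mu> L s \<tau> ri rd p0 a0 \<epsilon> k \<longrightarrow>
            adg_step d h f \<mu> L s \<tau> ri rd p0 a0 k \<ge> \<tau>) \<and>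
         (\<exists>K. \<forall>\<epsilon>>0. \<forall>k. performed d h f \<mu> L s \<tau> ri rd p0 a0 \<epsilon> k \<longrightarrow>
            f (adg_x d h f \<mu> L s \<tau> ri rd p0 a0 (Suc k)) - f xstar
              \<le> K * exp (- (sqrt \<mu> / 4) * (\<Sum>i=0..k. adg_step d h f \<mu> L s \<tau> ri rd p0 a0 i)))"
proof -
  interpret smooth_strongly_convex f \<mu> L s xstar
    using assms by unfold_locales auto
  note params = assms(8-13)
  let ?state = "adg_state d h f \<mu> L s \<tau> ri rd p0 a0"
  \<comment> \<open>A positive tolerance excludes a zero gradient at every iteration
    performed.\<close>
  have grad: "\<forall>j\<le>k. grad f (fst (fst (?state j))) \<noteq> 0"
    if "0 < \<epsilon>" "performed d h f \<mu> L s \<tau> ri rd p0 a0 \<epsilon> k" for \<epsilon> k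
    using that unfolding performed_def adg_x_def by (metis norm_zero not_le)
  note invariant = adg_invariant[OF params \<open>a0 \<ge> 0\<close>]
  have iteration: "adg_search d h f \<mu> L s \<tau> ri rd p0 a0 k \<noteq> None \<and> \<tau> \<le> adg_step d h f \<mu> L s \<tau> ri rd p0 a0 k"
    if "0 < \<epsilon>" "performed d h f \<mu> L s \<tau> ri rd p0 a0 \<epsilon> k" for \<epsilon> k
    using adg_iteration(1,2)[OF params \<open>a0 \<ge> 0\<close> invariant(1)] grad[OF that] by auto
  \<comment> \<open>The constant is \<open>lyap p0\<close>, independent of the tolerance and of
    \<open>k\<close>; the invariant at \<open>Suc k\<close> sums the steps 0 to
    \<open>k\<close>.\<close>
  have decay: "f (adg_x d h f \<mu> L s \<tau> ri rd p0 a0 (Suc k)) - f xstar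
      \<le> lyap p0 * exp (- (sqrt \<mu> / 4) * (\<Sum>i=0..k. adg_step d h f \<mu> L s \<tau> ri rd p0 a0 i))"
    if "0 < \<epsilon>" "performed d h f \<mu> L s \<tau> ri rd p0 a0 \<epsilon> k" for \<epsilon> k
  proof -
    have "f (fst (fst (?state (Suc k)))) - f xstar \<le> lyap (fst (?state (Suc k)))"
      by (rule suboptimality_le_lyap)
    also have "\<dots> \<le> lyap p0 * exp (- (r / 4) * (\<Sum>i<Suc k. adg_step d h f \<mu> L s \<tau> ri rd p0 a0 i))"
      using grad[OF that] by (intro invariant(2)) auto
    finally show ?thesis
      by (simp add: adg_x_def atLeast0AtMost lessThan_Suc_atMost del: adg_state.simps)
  qed
  show ?thesis
    using iteration decay by blast
qed

end
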